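(* Let $G$ be a Carnot group. A horizontal curve in $G$ is a nonholonomic geodesic if and only if it is an integral curve of a left-invariant horizontal vector field.
   Context: A Carnot group $G$ is a connected, simply connected Lie group whose Lie algebra has a grading $\mathcal G=V_1\oplus\cdots\oplus V_l$ with $[V_1,V_i]=V_{i+1}$ for $1\le i\le l-1$ and $[V_1,V_l]=0$. Let $\{e_1,\dots,e_m\}$ be a basis of $\mathcal G$ adapted to the grading, with $e_1,\dots,e_k$ a basis of $V_1$, and let $X_i$ be the left-invariant vector field with value $e_i$ at the identity. The horizontal bundle is $\Sigma=\mathrm{span}\{X_1,\dots,X_k\}$, $g$ is the left-invariant Riemannian metric for which $X_1,\dots,X_m$ are orthonormal, and $g_c=g|_\Sigma$. Let $\nabla$ be the Levi-Civita connection of $g$ and $\mathcal P$ the $g$-orthogonal projection onto $\Sigma$. A curve $\gamma$ is horizontal if $\dot\gamma\in\Sigma_\gamma$. A nonholonomic geodesic is a smooth horizontal curve with $D_{\dot\gamma}\dot\gamma:=\mathcal P(\nabla_{\dot\gamma}\dot\gamma)=0$. A left-invariant horizontal vector field is a linear combination of $X_1,\dots,X_k$ with constant coefficients. *)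

theory Defs
  imports
    "HOL-Analysis.Analysis"
    "HOL-Algebra.Group"
    "HOL-Library.Function_Algebras"
begin

section \<open>Functions as a real vector space\<close>

text \<open>
  Tangent vectors are functionals on real functions, so they live in the vector space below;
  this makes \<^const>\<open>span\<close>, \<^const>\<open>subspace\<close> and
  \<^const>\<open>independent\<close> available for them.
\<close>

instantiation "fun" :: (type, real_vector) real_vector
begin

definition scaleR_fun_def: "c *\<^sub>R f = (\<lambda>x. c *\<^sub>R f x)"

instance
  by standard (simp_all add: scaleR_fun_def fun_eq_iff scaleR_add_right scaleR_add_left)

end

lemma scaleR_fun_apply [simp]: "(c *\<^sub>R f) x = c *\<^sub>R f x"
  by (simp add: scaleR_fun_def)

definition basis_on :: "(nat \<Rightarrow> 'v::real_vector) \<Rightarrow> nat set \<Rightarrow> 'v set \<Rightarrow> bool" where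
  "basis_on e I W \<longleftrightarrow> inj_on e I \<and> independent (e ` I) \<and> span (e ` I) = W"


section \<open>Smooth functions and smooth manifolds\<close>

text \<open>
  Used only for open sets and for (relatively open subsets of) nondegenerate intervals of the
  line, where derivatives within the set are unique; at an end point of an interval they are
  one-sided derivatives.
\<close>

fun Ck_on :: "nat \<Rightarrow> 'e::euclidean_space set \<Rightarrow> ('e \<Rightarrow> 'f::euclidean_space) \<Rightarrow> bool" where
  "Ck_on 0 S f \<longleftrightarrow> continuous_on S f"
| "Ck_on (Suc k) S f \<longleftrightarrow>
     (\<exists>f'. (\<forall>x\<in>S. (f has_derivative f' x) (at x within S)) \<and> (\<forall>v. Ck_on k S (\<lambda>x. f' x v)))"

definition smooth_on :: "'e::euclidean_space set \<Rightarrow> ('e \<Rightarrow> 'f::euclidean_space) \<Rightarrow> bool" where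
  "smooth_on S f \<longleftrightarrow> (\<forall>k. Ck_on k S f)"

text \<open>
  The manifold is the whole type \<open>'a\<close>; a chart \<open>(U, \<phi>)\<close> has domain \<open>U\<close>, and values of \<open>\<phi>\<close>
  outside \<open>U\<close> are irrelevant.
\<close>

type_synonym ('a, 'e) chart = "'a set \<times> ('a \<Rightarrow> 'e)"

definition smooth_atlas ::
  "('a::{t2_space, second_countable_topology}, 'e::euclidean_space) chart set \<Rightarrow> bool" where
  "smooth_atlas A \<longleftrightarrow>
     (\<Union>(U, \<phi>)\<in>A. U) = UNIV \<and>
     (\<forall>(U, \<phi>)\<in>A. open U \<and> open (\<phi> ` U) \<and> homeomorphism U (\<phi> ` U) \<phi> (inv_into U \<phi>)) \<and>
     (\<forall>(U, \<phi>)\<in>A. \<forall>(V, \<psi>)\<in>A. smooth_on (\<phi> ` (U \<inter> V)) (\<psi> \<circ> inv_into U \<phi>))"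

definition smooth_funs :: "('a, 'e::euclidean_space) chart set \<Rightarrow> ('a \<Rightarrow> real) set" where
  "smooth_funs A = {f. \<forall>(U, \<phi>)\<in>A. smooth_on (\<phi> ` U) (f \<circ> inv_into U \<phi>)}"


section \<open>Tangent vectors and vector fields\<close>

text \<open>
  Tangent vectors at \<open>p\<close> are the derivations at \<open>p\<close> of the algebra of smooth functions. They are
  made total by the value \<open>0\<close> on non-smooth functions, so that equality of tangent vectors is
  equality of derivations.
\<close>

type_synonym 'a tvec = "('a \<Rightarrow> real) \<Rightarrow> real"
type_synonym 'a vfield = "'a \<Rightarrow> 'a tvec"

definition tangent_space :: "('a, 'e::euclidean_space) chart set \<Rightarrow> 'a \<Rightarrow> 'a tvec set" where
  "tangent_space A p = {v.
     (\<forall>f. f \<notin> smooth_funs A \<longrightarrow> v f = 0) \<and>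
     (\<forall>f\<in>smooth_funs A. \<forall>c. v (c *\<^sub>R f) = c * v f) \<and>
     (\<forall>f\<in>smooth_funs A. \<forall>h\<in>smooth_funs A.
        v (f + h) = v f + v h \<and> v (f * h) = f p * v h + h p * v f)}"

definition dir_deriv :: "'a vfield \<Rightarrow> ('a \<Rightarrow> real) \<Rightarrow> 'a \<Rightarrow> real" where
  "dir_deriv X f = (\<lambda>p. X p f)"

definition vector_fields :: "('a, 'e::euclidean_space) chart set \<Rightarrow> 'a vfield set" where
  "vector_fields A = {X.
     (\<forall>p. X p \<in> tangent_space A p) \<and> (\<forall>f\<in>smooth_funs A. dir_deriv X f \<in> smooth_funs A)}"

definition fscale :: "('b \<Rightarrow> real) \<Rightarrow> ('b \<Rightarrow> 'a tvec) \<Rightarrow> 'b \<Rightarrow> 'a tvec" where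
  "fscale h X = (\<lambda>p. h p *\<^sub>R X p)"

definition lie_bracket :: "'a vfield \<Rightarrow> 'a vfield \<Rightarrow> 'a vfield" where
  "lie_bracket X Y = (\<lambda>p f. X p (dir_deriv Y f) - Y p (dir_deriv X f))"


section \<open>Lie groups and Carnot groups\<close>

definition lie_group ::
  "('a::{t2_space, second_countable_topology}, 'e::euclidean_space) chart set \<Rightarrow> 'a monoid \<Rightarrow> bool" where
  "lie_group A G \<longleftrightarrow>
     smooth_atlas A \<and> group G \<and> carrier G = UNIV \<and>
     continuous_on UNIV (\<lambda>(x, y). x \<otimes>\<^bsub>G\<^esub> y) \<and>
     (\<forall>(U, \<phi>)\<in>A. \<forall>(V, \<psi>)\<in>A. \<forall>(W, \<theta>)\<in>A.
        smooth_on {(x, y). x \<in> \<phi> ` U \<and> y \<in> \<psi> ` V \<and> inv_into U \<phi> x \<otimes>\<^bsub>G\<^esub> inv_into V \<psi> y \<in> W}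
          (\<lambda>(x, y). \<theta> (inv_into U \<phi> x \<otimes>\<^bsub>G\<^esub> inv_into V \<psi> y))) \<and>
     continuous_on UNIV (\<lambda>x. inv\<^bsub>G\<^esub> x) \<and>
     (\<forall>(U, \<phi>)\<in>A. \<forall>(W, \<theta>)\<in>A.
        smooth_on {x. x \<in> \<phi> ` U \<and> inv\<^bsub>G\<^esub> (inv_into U \<phi> x) \<in> W}
          (\<lambda>x. \<theta> (inv\<^bsub>G\<^esub> (inv_into U \<phi> x))))"

text \<open>The differential of the left translation by \<open>a\<close>.\<close>

definition ltrans :: "'a monoid \<Rightarrow> 'a \<Rightarrow> 'a tvec \<Rightarrow> 'a tvec" where
  "ltrans G a v = (\<lambda>f. v (\<lambda>x. f (a \<otimes>\<^bsub>G\<^esub> x)))"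

definition left_invariant_fields ::
  "('a, 'e::euclidean_space) chart set \<Rightarrow> 'a monoid \<Rightarrow> 'a vfield set" where
  "left_invariant_fields A G =
     {X \<in> vector_fields A. \<forall>a p. X (a \<otimes>\<^bsub>G\<^esub> p) = ltrans G a (X p)}"

text \<open>
  The Lie algebra is the tangent space at the identity, with the bracket transported from
  left-invariant vector fields; \<open>\<lambda>p. ltrans G p u\<close> is the left-invariant field with value \<open>u\<close>
  at the identity.
\<close>

definition lie_algebra :: "('a, 'e::euclidean_space) chart set \<Rightarrow> 'a monoid \<Rightarrow> 'a tvec set" where
  "lie_algebra A G = tangent_space A \<one>\<^bsub>G\<^esub>"

definition alg_bracket :: "'a monoid \<Rightarrow> 'a tvec \<Rightarrow> 'a tvec \<Rightarrow> 'a tvec" where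
  "alg_bracket G u v = lie_bracket (\<lambda>p. ltrans G p u) (\<lambda>p. ltrans G p v) \<one>\<^bsub>G\<^esub>"

definition carnot_grading ::
  "('a, 'e::euclidean_space) chart set \<Rightarrow> 'a monoid \<Rightarrow> nat \<Rightarrow> (nat \<Rightarrow> 'a tvec set) \<Rightarrow> bool" where
  "carnot_grading A G l V \<longleftrightarrow>
     1 \<le> l \<and>
     (\<forall>i\<in>{1..l}. subspace (V i) \<and> V i \<subseteq> lie_algebra A G) \<and>
     (\<forall>u\<in>lie_algebra A G.
        \<exists>!w. (\<forall>i\<in>{1..l}. w i \<in> V i) \<and> (\<forall>i. i \<notin> {1..l} \<longrightarrow> w i = 0) \<and> u = (\<Sum>i=1..l. w i)) \<and>
     (\<forall>i\<in>{1..<l}. span {alg_bracket G u v | u v. u \<in> V 1 \<and> v \<in> V i} = V (Suc i)) \<and>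
     (\<forall>u\<in>V 1. \<forall>v\<in>V l. alg_bracket G u v = 0)"

definition carnot_group ::
  "('a::{t2_space, second_countable_topology}, 'e::euclidean_space) chart set \<Rightarrow> 'a monoid \<Rightarrow>
   nat \<Rightarrow> (nat \<Rightarrow> 'a tvec set) \<Rightarrow> bool" where
  "carnot_group A G l V \<longleftrightarrow>
     lie_group A G \<and> connected (UNIV :: 'a set) \<and> simply_connected (UNIV :: 'a set) \<and>
     carnot_grading A G l V"

text \<open>
  In an adapted basis \<open>e 1, ..., e m\<close>, consecutive blocks are bases of \<open>V 1, ..., V l\<close>: the block
  of \<open>V j\<close> consists of the indices \<open>d (j - 1) < i \<le> d j\<close>. In particular \<open>e 1, ..., e k\<close> is a basis
  of \<open>V 1\<close>.
\<close>

definition adapted_basis ::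
  "('a, 'e::euclidean_space) chart set \<Rightarrow> 'a monoid \<Rightarrow> nat \<Rightarrow> (nat \<Rightarrow> 'a tvec set) \<Rightarrow>
   nat \<Rightarrow> nat \<Rightarrow> (nat \<Rightarrow> 'a tvec) \<Rightarrow> bool" where
  "adapted_basis A G l V m k e \<longleftrightarrow>
     basis_on e {1..m} (lie_algebra A G) \<and>
     (\<exists>d :: nat \<Rightarrow> nat. d 0 = 0 \<and> d 1 = k \<and> d l = m \<and>
        (\<forall>j\<in>{1..l}. d (j - 1) \<le> d j \<and> basis_on e {d (j - 1)<..d j} (V j)))"

definition horizontal_bundle :: "nat \<Rightarrow> (nat \<Rightarrow> 'a vfield) \<Rightarrow> 'a \<Rightarrow> 'a tvec set" where
  "horizontal_bundle k X p = span ((\<lambda>i. X i p) ` {1..k})"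

definition left_invariant_horizontal_fields :: "nat \<Rightarrow> (nat \<Rightarrow> 'a vfield) \<Rightarrow> 'a vfield set" where
  "left_invariant_horizontal_fields k X = {\<lambda>p. \<Sum>i=1..k. c i *\<^sub>R X i p | c :: nat \<Rightarrow> real. True}"


section \<open>Riemannian metrics and the Levi-Civita connection\<close>

definition riemannian_metric ::
  "('a, 'e::euclidean_space) chart set \<Rightarrow> ('a \<Rightarrow> 'a tvec \<Rightarrow> 'a tvec \<Rightarrow> real) \<Rightarrow> bool" where
  "riemannian_metric A g \<longleftrightarrow>
     (\<forall>p. \<forall>u\<in>tangent_space A p. \<forall>v\<in>tangent_space A p.
        g p u v = g p v u \<and>
        (\<forall>c. g p (c *\<^sub>R u) v = c * g p u v) \<and>
        (\<forall>w\<in>tangent_space A p. g p (u + w) v = g p u v + g p w v) \<and>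
        (u \<noteq> 0 \<longrightarrow> g p u u > 0)) \<and>
     (\<forall>X\<in>vector_fields A. \<forall>Y\<in>vector_fields A. (\<lambda>p. g p (X p) (Y p)) \<in> smooth_funs A)"

definition left_invariant_metric ::
  "('a, 'e::euclidean_space) chart set \<Rightarrow> 'a monoid \<Rightarrow> ('a \<Rightarrow> 'a tvec \<Rightarrow> 'a tvec \<Rightarrow> real) \<Rightarrow> bool" where
  "left_invariant_metric A G g \<longleftrightarrow>
     riemannian_metric A g \<and>
     (\<forall>a p. \<forall>u\<in>tangent_space A p. \<forall>v\<in>tangent_space A p.
        g (a \<otimes>\<^bsub>G\<^esub> p) (ltrans G a u) (ltrans G a v) = g p u v)"

definition affine_connection ::
  "('a, 'e::euclidean_space) chart set \<Rightarrow> ('a vfield \<Rightarrow> 'a vfield \<Rightarrow> 'a vfield) \<Rightarrow> bool" where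
  "affine_connection A nabla \<longleftrightarrow>
     (\<forall>X\<in>vector_fields A. \<forall>Y\<in>vector_fields A.
        nabla X Y \<in> vector_fields A \<and>
        (\<forall>Z\<in>vector_fields A.
           nabla (X + Z) Y = nabla X Y + nabla Z Y \<and> nabla X (Y + Z) = nabla X Y + nabla X Z) \<and>
        (\<forall>h\<in>smooth_funs A.
           nabla (fscale h X) Y = fscale h (nabla X Y) \<and>
           nabla X (fscale h Y) = fscale (dir_deriv X h) Y + fscale h (nabla X Y)))"

definition levi_civita ::
  "('a, 'e::euclidean_space) chart set \<Rightarrow> ('a \<Rightarrow> 'a tvec \<Rightarrow> 'a tvec \<Rightarrow> real) \<Rightarrow>
   ('a vfield \<Rightarrow> 'a vfield \<Rightarrow> 'a vfield) \<Rightarrow> bool" where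
  "levi_civita A g nabla \<longleftrightarrow>
     affine_connection A nabla \<and>
     (\<forall>X\<in>vector_fields A. \<forall>Y\<in>vector_fields A. nabla X Y - nabla Y X = lie_bracket X Y) \<and>
     (\<forall>X\<in>vector_fields A. \<forall>Y\<in>vector_fields A. \<forall>Z\<in>vector_fields A.
        dir_deriv X (\<lambda>p. g p (Y p) (Z p)) =
          (\<lambda>p. g p (nabla X Y p) (Z p) + g p (Y p) (nabla X Z p)))"

definition orthogonal_projection ::
  "('a \<Rightarrow> 'a tvec \<Rightarrow> 'a tvec \<Rightarrow> real) \<Rightarrow> ('a \<Rightarrow> 'a tvec set) \<Rightarrow> 'a \<Rightarrow> 'a tvec \<Rightarrow> 'a tvec" where
  "orthogonal_projection g H p u = (THE w. w \<in> H p \<and> (\<forall>z\<in>H p. g p (u - w) z = 0))"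


section \<open>Curves and nonholonomic geodesics\<close>

text \<open>In what follows \<open>J\<close> is an interval with nonempty interior, not necessarily open.\<close>

definition differentiable_curve ::
  "('a::topological_space, 'e::euclidean_space) chart set \<Rightarrow> real set \<Rightarrow> (real \<Rightarrow> 'a) \<Rightarrow> bool" where
  "differentiable_curve A J \<gamma> \<longleftrightarrow>
     continuous_on J \<gamma> \<and>
     (\<forall>(U, \<phi>)\<in>A. \<forall>t\<in>J. \<gamma> t \<in> U \<longrightarrow> (\<phi> \<circ> \<gamma>) differentiable (at t within J))"

definition smooth_curve ::
  "('a::topological_space, 'e::euclidean_space) chart set \<Rightarrow> real set \<Rightarrow> (real \<Rightarrow> 'a) \<Rightarrow> bool" where
  "smooth_curve A J \<gamma> \<longleftrightarrow>
     continuous_on J \<gamma> \<and> (\<forall>(U, \<phi>)\<in>A. smooth_on {t\<in>J. \<gamma> t \<in> U} (\<phi> \<circ> \<gamma>))"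

definition velocity ::
  "('a, 'e::euclidean_space) chart set \<Rightarrow> real set \<Rightarrow> (real \<Rightarrow> 'a) \<Rightarrow> real \<Rightarrow> 'a tvec" where
  "velocity A J \<gamma> t =
     (\<lambda>f. if f \<in> smooth_funs A then vector_derivative (f \<circ> \<gamma>) (at t within J) else 0)"

definition horizontal_curve ::
  "('a::topological_space, 'e::euclidean_space) chart set \<Rightarrow> ('a \<Rightarrow> 'a tvec set) \<Rightarrow>
   real set \<Rightarrow> (real \<Rightarrow> 'a) \<Rightarrow> bool" where
  "horizontal_curve A H J \<gamma> \<longleftrightarrow>
     differentiable_curve A J \<gamma> \<and> (\<forall>t\<in>J. velocity A J \<gamma> t \<in> H (\<gamma> t))"

definition integral_curve ::
  "('a::topological_space, 'e::euclidean_space) chart set \<Rightarrow> 'a vfield \<Rightarrow>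
   real set \<Rightarrow> (real \<Rightarrow> 'a) \<Rightarrow> bool" where
  "integral_curve A X J \<gamma> \<longleftrightarrow>
     differentiable_curve A J \<gamma> \<and> (\<forall>t\<in>J. velocity A J \<gamma> t = X (\<gamma> t))"

definition fields_along ::
  "('a, 'e::euclidean_space) chart set \<Rightarrow> real set \<Rightarrow> (real \<Rightarrow> 'a) \<Rightarrow> (real \<Rightarrow> 'a tvec) set" where
  "fields_along A J \<gamma> = {V.
     (\<forall>t\<in>J. V t \<in> tangent_space A (\<gamma> t)) \<and> (\<forall>f\<in>smooth_funs A. smooth_on J (\<lambda>t. V t f))}"

text \<open>
  The covariant derivative along a smooth curve is the unique operator on vector fields along the
  curve that is linear, satisfies the product rule and agrees with the connection on restrictions
  to the curve of vector fields of the manifold. Fields along the curve are total functions, of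
  which only the values on \<open>J\<close> matter; this is the first clause. In the last clause \<open>X\<close> is any
  extension of the velocity vector at the single time \<open>t\<close>. The choice operator below is
  determined on \<open>J\<close> by the uniqueness.
\<close>

definition is_covariant_derivative_along ::
  "('a, 'e::euclidean_space) chart set \<Rightarrow> ('a vfield \<Rightarrow> 'a vfield \<Rightarrow> 'a vfield) \<Rightarrow>
   real set \<Rightarrow> (real \<Rightarrow> 'a) \<Rightarrow> ((real \<Rightarrow> 'a tvec) \<Rightarrow> real \<Rightarrow> 'a tvec) \<Rightarrow> bool" where
  "is_covariant_derivative_along A nabla J \<gamma> D \<longleftrightarrow>
     (\<forall>V\<in>fields_along A J \<gamma>. \<forall>W\<in>fields_along A J \<gamma>.
        (\<forall>t\<in>J. V t = W t) \<longrightarrow> (\<forall>t\<in>J. D V t = D W t)) \<and>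
     (\<forall>V\<in>fields_along A J \<gamma>. D V \<in> fields_along A J \<gamma>) \<and>
     (\<forall>V\<in>fields_along A J \<gamma>. \<forall>W\<in>fields_along A J \<gamma>. \<forall>t\<in>J. D (V + W) t = D V t + D W t) \<and>
     (\<forall>V\<in>fields_along A J \<gamma>. \<forall>c. \<forall>t\<in>J. D (c *\<^sub>R V) t = c *\<^sub>R D V t) \<and>
     (\<forall>V\<in>fields_along A J \<gamma>. \<forall>h. smooth_on J h \<longrightarrow>
        (\<forall>t\<in>J. D (fscale h V) t = vector_derivative h (at t within J) *\<^sub>R V t + h t *\<^sub>R D V t)) \<and>
     (\<forall>X\<in>vector_fields A. \<forall>Y\<in>vector_fields A. \<forall>t\<in>J.
        X (\<gamma> t) = velocity A J \<gamma> t \<longrightarrow> D (Y \<circ> \<gamma>) t = nabla X Y (\<gamma> t))"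

definition covariant_derivative_along ::
  "('a, 'e::euclidean_space) chart set \<Rightarrow> ('a vfield \<Rightarrow> 'a vfield \<Rightarrow> 'a vfield) \<Rightarrow>
   real set \<Rightarrow> (real \<Rightarrow> 'a) \<Rightarrow> (real \<Rightarrow> 'a tvec) \<Rightarrow> real \<Rightarrow> 'a tvec" where
  "covariant_derivative_along A nabla J \<gamma> = (SOME D. is_covariant_derivative_along A nabla J \<gamma> D)"

definition nonholonomic_geodesic ::
  "('a::topological_space, 'e::euclidean_space) chart set \<Rightarrow>
   ('a \<Rightarrow> 'a tvec \<Rightarrow> 'a tvec \<Rightarrow> real) \<Rightarrow> ('a vfield \<Rightarrow> 'a vfield \<Rightarrow> 'a vfield) \<Rightarrow>
   ('a \<Rightarrow> 'a tvec set) \<Rightarrow> real set \<Rightarrow> (real \<Rightarrow> 'a) \<Rightarrow> bool" where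
  "nonholonomic_geodesic A g nabla H J \<gamma> \<longleftrightarrow>
     smooth_curve A J \<gamma> \<and> horizontal_curve A H J \<gamma> \<and>
     (\<forall>t\<in>J. orthogonal_projection g H (\<gamma> t)
               (covariant_derivative_along A nabla J \<gamma> (velocity A J \<gamma>) t) = 0)"

end

theory Submission
  imports Defs
begin

text \<open>
  The left-invariant fields \<open>X 1, ..., X m\<close> form a global orthonormal frame, and the theorem is a
  computation in this frame. Write the velocity of a horizontal curve as the sum of \<open>u\<^sub>i X\<^sub>i\<close> over the
  horizontal indices \<open>i \<le> k\<close>. The product rule gives the acceleration
  \<open>\<Sum> u\<^sub>i' X\<^sub>i + \<Sum> u\<^sub>i u\<^sub>j \<nabla>\<^sub>j X\<^sub>i\<close>. By the grading, brackets of horizontal frame fields are combinations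
  of the fields of the second layer and hence orthogonal to the horizontal bundle. Together with
  metricity and vanishing torsion this makes \<open>\<nabla>\<^sub>j X\<^sub>i\<close> orthogonal to the horizontal bundle
  (\<open>nabla_frame_orthogonal\<close>). So the projected acceleration is \<open>\<Sum> u\<^sub>i' X\<^sub>i\<close>
  (\<open>projected_acceleration\<close>), and it vanishes if and only if the \<open>u\<^sub>i\<close> are constant, which says that
  the curve is an integral curve of the left-invariant field \<open>\<Sum> u\<^sub>i X\<^sub>i\<close>.

  Three points need analysis. The covariant derivative along a curve is a choice among the operators
  that satisfy its axioms, so such an operator has to be constructed and shown to be unique
  (\<open>frame_cov_is_covariant_derivative\<close>, \<open>covariant_derivative_unique\<close>). The construction
  differentiates the coefficients of a field along the curve, whose smoothness has to be extracted
  from the action of the field on smooth functions (\<open>coef_smooth\<close>); this is Gaussian elimination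
  with smooth coefficients (\<open>smooth_near_coefficients\<close>). Finally, an integral curve is a priori only
  differentiable. It is smooth because all smooth functions are smooth along it
  (\<open>integral_curve_smooth\<close>), and bump functions make this enough for smoothness in charts
  (\<open>smooth_curveI\<close>).
\<close>

section \<open>Calculus of functions of class \<open>C\<^sup>k\<close>\<close>

lemma Ck_on_cong:
  assumes "Ck_on k S f" "\<And>x. x \<in> S \<Longrightarrow> f x = h x"
  shows "Ck_on k S h"
proof (cases k)
  case 0
  then show ?thesis using assms by (metis Ck_on.simps(1) continuous_on_cong)
next
  case (Suc n)
  then show ?thesis using assms
    by (auto intro!: has_derivative_transform[of _ S h f])
qed

lemma Ck_on_subset: "Ck_on k S f \<Longrightarrow> T \<subseteq> S \<Longrightarrow> Ck_on k T f"
proof (induction k arbitrary: f)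
  case 0
  then show ?case by (auto intro: continuous_on_subset)
next
  case (Suc k)
  then obtain f' where f': "\<forall>x\<in>S. (f has_derivative f' x) (at x within S)"
    "\<forall>v. Ck_on k S (\<lambda>x. f' x v)" by auto
  show ?case unfolding Ck_on.simps
    by (rule exI[of _ f']) (use f' Suc in \<open>blast intro: has_derivative_subset\<close>)
qed

lemma Ck_on_SucD: "Ck_on (Suc k) S f \<Longrightarrow> Ck_on k S f"
proof (induction k arbitrary: f)
  case 0
  then show ?case
    by (auto simp: continuous_on_eq_continuous_within intro: has_derivative_continuous)
next
  case (Suc k)
  from Suc.prems obtain f' where f': "\<forall>x\<in>S. (f has_derivative f' x) (at x within S)"
    "\<forall>v. Ck_on (Suc k) S (\<lambda>x. f' x v)" unfolding Ck_on.simps(2)[of "Suc k"] by blast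
  show ?case unfolding Ck_on.simps(2)[of k]
    by (rule exI[of _ f']) (use f' Suc.IH in blast)
qed

lemma Ck_on_const: "Ck_on k S (\<lambda>x. c)"
proof (induction k arbitrary: c)
  case (Suc k)
  show ?case unfolding Ck_on.simps
    by (rule exI[of _ "\<lambda>x v. 0"]) (use Suc in auto)
qed auto

lemma Ck_on_bounded_linear:
  assumes "bounded_linear L" shows "Ck_on k S L"
proof (cases k)
  case 0
  then show ?thesis using assms by (simp add: linear_continuous_on)
next
  case (Suc n)
  then show ?thesis using assms
    by (auto intro!: exI[of _ "\<lambda>x. L"] bounded_linear_imp_has_derivative Ck_on_const)
qed

lemma Ck_on_add: "Ck_on k S f \<Longrightarrow> Ck_on k S h \<Longrightarrow> Ck_on k S (\<lambda>x. f x + h x)"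
proof (induction k arbitrary: f h)
  case 0
  then show ?case by (auto intro: continuous_intros)
next
  case (Suc k)
  from Suc.prems obtain f' h' where d:
    "\<forall>x\<in>S. (f has_derivative f' x) (at x within S)" "\<forall>v. Ck_on k S (\<lambda>x. f' x v)"
    "\<forall>x\<in>S. (h has_derivative h' x) (at x within S)" "\<forall>v. Ck_on k S (\<lambda>x. h' x v)" by auto
  show ?case unfolding Ck_on.simps
    by (rule exI[of _ "\<lambda>x v. f' x v + h' x v"])
      (use d Suc.IH in \<open>auto intro: has_derivative_add\<close>)
qed

lemma Ck_on_sum: "(\<And>i. i \<in> I \<Longrightarrow> Ck_on k S (f i)) \<Longrightarrow> Ck_on k S (\<lambda>x. \<Sum>i\<in>I. f i x)"
  by (induction I rule: infinite_finite_induct) (auto intro: Ck_on_const Ck_on_add)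

lemma Ck_on_linear_comp:
  assumes L: "bounded_linear L"
  shows "Ck_on k S f \<Longrightarrow> Ck_on k S (\<lambda>x. L (f x))"
proof (induction k arbitrary: f)
  case 0
  then show ?case using L by (auto intro: bounded_linear.continuous_on)
next
  case (Suc k)
  from Suc.prems obtain f' where d:
    "\<forall>x\<in>S. (f has_derivative f' x) (at x within S)" "\<forall>v. Ck_on k S (\<lambda>x. f' x v)" by auto
  show ?case unfolding Ck_on.simps
    by (rule exI[of _ "\<lambda>x v. L (f' x v)"])
      (use d Suc.IH L in \<open>auto intro: bounded_linear.has_derivative\<close>)
qed

lemma Ck_on_mult:
  fixes f h :: "'e::euclidean_space \<Rightarrow> real"
  shows "Ck_on k S f \<Longrightarrow> Ck_on k S h \<Longrightarrow> Ck_on k S (\<lambda>x. f x * h x)"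
proof (induction k arbitrary: f h)
  case 0
  then show ?case by (auto intro: continuous_intros)
next
  case (Suc k)
  from Suc.prems obtain f' h' where d:
    "\<forall>x\<in>S. (f has_derivative f' x) (at x within S)" "\<forall>v. Ck_on k S (\<lambda>x. f' x v)"
    "\<forall>x\<in>S. (h has_derivative h' x) (at x within S)" "\<forall>v. Ck_on k S (\<lambda>x. h' x v)" by auto
  show ?case unfolding Ck_on.simps
    by (rule exI[of _ "\<lambda>x v. f x * h' x v + f' x v * h x"])
      (use d in \<open>auto intro!: has_derivative_mult Ck_on_add
        Suc.IH[OF Ck_on_SucD[OF Suc.prems(1)]] Suc.IH[OF _ Ck_on_SucD[OF Suc.prems(2)]]\<close>)
qed

lemma Ck_on_inverse:
  fixes f :: "'e::euclidean_space \<Rightarrow> real"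
  shows "Ck_on k S f \<Longrightarrow> (\<And>x. x \<in> S \<Longrightarrow> f x \<noteq> 0) \<Longrightarrow> Ck_on k S (\<lambda>x. inverse (f x))"
proof (induction k)
  case 0
  then show ?case by (auto intro: continuous_intros)
next
  case (Suc k)
  from Suc.prems obtain f' where d:
    "\<forall>x\<in>S. (f has_derivative f' x) (at x within S)" "\<forall>v. Ck_on k S (\<lambda>x. f' x v)" by auto
  have i: "Ck_on k S (\<lambda>x. inverse (f x))"
    using Suc.IH[OF Ck_on_SucD[OF Suc.prems(1)] Suc.prems(2)] .
  have "Ck_on k S (\<lambda>x. (- 1) * (inverse (f x) * f' x v * inverse (f x)))" for v
    by (intro Ck_on_mult Ck_on_const i) (use d in auto)
  then show ?case unfolding Ck_on.simps
    by (intro exI[of _ "\<lambda>x v. - (inverse (f x) * f' x v * inverse (f x))"])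
      (use d Suc.prems in \<open>auto intro!: has_derivative_inverse\<close>)
qed

text \<open>
  The derivative of \<open>h \<circ> c\<close> in direction \<open>v\<close> is the sum over the basis vectors \<open>b\<close> of the products
  of the \<open>b\<close>-component of \<open>c' x v\<close> with the partial derivative of \<open>h\<close> along \<open>b\<close>, which is a
  composition again; this is what makes the induction on the order of differentiability work.
\<close>

lemma Ck_on_compose:
  fixes h :: "'e::euclidean_space \<Rightarrow> real" and c :: "'d::euclidean_space \<Rightarrow> 'e"
  shows "Ck_on k T h \<Longrightarrow> Ck_on k S c \<Longrightarrow> c ` S \<subseteq> T \<Longrightarrow> Ck_on k S (\<lambda>x. h (c x))"
proof (induction k arbitrary: h)
  case 0
  then show ?case by (auto intro: continuous_on_compose2)
next
  case (Suc k)
  from Suc.prems obtain h' c' where d: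
    "\<forall>x\<in>T. (h has_derivative h' x) (at x within T)" "\<forall>v. Ck_on k T (\<lambda>x. h' x v)"
    "\<forall>x\<in>S. (c has_derivative c' x) (at x within S)" "\<forall>v. Ck_on k S (\<lambda>x. c' x v)" by auto
  have "Ck_on k S (\<lambda>x. h' (c x) v)" for v
    by (rule Suc.IH[OF _ Ck_on_SucD[OF Suc.prems(2)] Suc.prems(3)]) (use d in auto)
  moreover have "Ck_on k S (\<lambda>x. c' x v \<bullet> b)" for v b
    by (rule Ck_on_linear_comp[OF bounded_linear_inner_left]) (use d in auto)
  ultimately have s: "Ck_on k S (\<lambda>x. \<Sum>b\<in>Basis. (c' x v \<bullet> b) * h' (c x) b)" for v
    by (intro Ck_on_sum Ck_on_mult)
  have chain: "((\<lambda>x. h (c x)) has_derivative (\<lambda>v. h' (c x) (c' x v))) (at x within S)" if "x \<in> S" for x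
  proof -
    have "(h has_derivative h' (c x)) (at (c x) within c ` S)"
      using d Suc.prems that by (meson has_derivative_subset image_subset_iff)
    with d that show ?thesis using diff_chain_within[of c "c' x" x S h] by (auto simp: o_def)
  qed
  have "h' (c x) (c' x v) = (\<Sum>b\<in>Basis. (c' x v \<bullet> b) * h' (c x) b)" if "x \<in> S" for x v
  proof -
    have l: "linear (h' (c x))"
      using d Suc.prems that by (meson has_derivative_linear image_subset_iff)
    have "h' (c x) (c' x v) = h' (c x) (\<Sum>b\<in>Basis. (c' x v \<bullet> b) *\<^sub>R b)"
      by (simp add: euclidean_representation)
    also have "\<dots> = (\<Sum>b\<in>Basis. (c' x v \<bullet> b) * h' (c x) b)"
      by (simp add: linear_sum[OF l] linear_cmul[OF l])
    finally show ?thesis .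
  qed
  then have "Ck_on k S (\<lambda>x. h' (c x) (c' x v))" for v
    by (intro Ck_on_cong[OF s[of v]]) simp
  then show ?case unfolding Ck_on.simps
    by (intro exI[of _ "\<lambda>x v. h' (c x) (c' x v)"]) (use chain in blast)
qed

text \<open>
  Derivatives within such a set are unique, because every point is approached within the set
  along all coordinate directions.
\<close>

definition approachable :: "'e::euclidean_space set \<Rightarrow> bool" where
  "approachable S \<longleftrightarrow>
     (\<forall>x\<in>S. \<forall>i\<in>Basis. \<forall>e>0. \<exists>d. 0 < \<bar>d\<bar> \<and> \<bar>d\<bar> < e \<and> x + d *\<^sub>R i \<in> S)"

lemma approachable_Int_open:
  assumes S: "approachable S" and U: "open U"
  shows "approachable (S \<inter> U)"
  unfolding approachable_def
proof (intro ballI allI impI)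
  fix x i :: 'a and e :: real assume x: "x \<in> S \<inter> U" "i \<in> Basis" "0 < e"
  obtain r where r: "r > 0" "ball x r \<subseteq> U" using U x by (meson IntE openE)
  obtain d where d: "0 < \<bar>d\<bar>" "\<bar>d\<bar> < min e r" "x + d *\<^sub>R i \<in> S"
    using S x r unfolding approachable_def by (metis IntD1 min_less_iff_conj)
  have "x + d *\<^sub>R i \<in> ball x r" using d x by (simp add: dist_norm)
  then show "\<exists>d. 0 < \<bar>d\<bar> \<and> \<bar>d\<bar> < e \<and> x + d *\<^sub>R i \<in> S \<inter> U" using d r by auto
qed

lemma approachable_open: "open U \<Longrightarrow> approachable U"
proof -
  have "approachable (UNIV :: 'a set)" unfolding approachable_def
  proof (intro ballI allI impI)
    fix x i :: 'a and e :: real assume "0 < e"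
    then show "\<exists>d. 0 < \<bar>d\<bar> \<and> \<bar>d\<bar> < e \<and> x + d *\<^sub>R i \<in> UNIV" by (intro exI[of _ "e/2"]) auto
  qed
  then show "open U \<Longrightarrow> approachable U" using approachable_Int_open[of UNIV U] by simp
qed

lemma approachable_interval:
  fixes J :: "real set"
  assumes J: "is_interval J" "interior J \<noteq> {}"
  shows "approachable J"
  unfolding approachable_def
proof (intro ballI allI impI)
  fix x i e :: real assume x: "x \<in> J" "i \<in> Basis" "0 < e"
  obtain c r where c: "r > 0" "ball c r \<subseteq> J" using J by (meson ex_in_conv mem_interior)
  obtain y where y: "y \<in> J" "y \<noteq> x"
  proof (cases "c = x")
    case True
    have "c + r/2 \<in> ball c r" using c by (simp add: dist_real_def)
    then show ?thesis using that[of "c + r/2"] c True by auto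
  next
    case False
    moreover have "c \<in> J" using c by (meson centre_in_ball subsetD)
    ultimately show ?thesis using that[of c] by blast
  qed
  \<comment> \<open>walk from \<open>x\<close> towards \<open>y\<close> by less than \<open>e\<close>, staying in the interval by convexity\<close>
  define s where "s = min 1 (e / (2 * \<bar>y - x\<bar>))"
  have s: "0 < s" "s \<le> 1" "s \<le> e / (2 * \<bar>y - x\<bar>)" using x y by (auto simp: s_def)
  have "s * \<bar>y - x\<bar> \<le> e / (2 * \<bar>y - x\<bar>) * \<bar>y - x\<bar>"
    by (rule mult_right_mono) (use s in auto)
  also have "\<dots> = e / 2" using y by simp
  finally have e: "\<bar>s * (y - x)\<bar> < e" using s x by (simp add: abs_mult)
  have "(1 - s) *\<^sub>R x + s *\<^sub>R y \<in> J"
    using J(1) x y s unfolding is_interval_convex_1 convex_alt by auto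
  then have "x + (s * (y - x)) *\<^sub>R i \<in> J" using x(2) by (simp add: algebra_simps)
  then show "\<exists>d. 0 < \<bar>d\<bar> \<and> \<bar>d\<bar> < e \<and> x + d *\<^sub>R i \<in> J"
    using e s y by (intro exI[of _ "s * (y - x)"]) auto
qed

lemma has_derivative_unique_approachable:
  fixes f :: "'e::euclidean_space \<Rightarrow> 'f::euclidean_space"
  assumes "approachable S" "x \<in> S"
    "(f has_derivative f') (at x within S)" "(f has_derivative f'') (at x within S)"
  shows "f' = f''"
  by (rule frechet_derivative_unique_within[of f f' x S f''])
     (use assms in \<open>auto simp: approachable_def\<close>)

text \<open>
  Derivatives at a point depend only on a neighbourhood of it, and the derivatives found on the
  different neighbourhoods agree because they are unique on an approachable set.
\<close>

lemma Ck_on_local: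
  assumes S: "approachable S"
  shows "(\<And>x. x \<in> S \<Longrightarrow> \<exists>U. open U \<and> x \<in> U \<and> Ck_on k (S \<inter> U) f) \<Longrightarrow> Ck_on k S f"
proof (induction k arbitrary: f)
  case 0
  have "continuous (at x within S) f" if x: "x \<in> S" for x
  proof -
    obtain U where U: "open U" "x \<in> U" "continuous_on (S \<inter> U) f" using 0 x by auto
    then have "continuous (at x within S \<inter> U) f"
      using x by (simp add: continuous_on_eq_continuous_within)
    moreover have "at x within S \<inter> U = at x within S"
      by (rule at_within_nhd[of x U]) (use U in auto)
    ultimately show ?thesis by simp
  qed
  then show ?case by (simp add: continuous_on_eq_continuous_within)
next
  case (Suc k)
  have at_eq: "at x within S \<inter> U = at x within S" if "open U" "x \<in> U" for x U
    by (rule at_within_nhd[of x U]) (use that in auto)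
  have "\<exists>F. (f has_derivative F) (at x within S)" if x: "x \<in> S" for x
  proof -
    obtain U F where "open U" "x \<in> U" "\<forall>y\<in>S \<inter> U. (f has_derivative F y) (at y within S \<inter> U)"
      using Suc.prems[OF x] by auto
    then have "(f has_derivative F x) (at x within S)" using x at_eq[of U x] by (metis IntI)
    then show ?thesis by blast
  qed
  then obtain f' where f': "\<And>x. x \<in> S \<Longrightarrow> (f has_derivative f' x) (at x within S)" by metis
  have "Ck_on k S (\<lambda>x. f' x v)" for v
  proof (rule Suc.IH)
    fix x assume x: "x \<in> S"
    obtain U F where U: "open U" "x \<in> U" 
      and F: "\<forall>y\<in>S \<inter> U. (f has_derivative F y) (at y within S \<inter> U)"
        "\<forall>v. Ck_on k (S \<inter> U) (\<lambda>x. F x v)" using Suc.prems[OF x] by auto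
    have "F y = f' y" if y: "y \<in> S \<inter> U" for y
    proof -
      have "(f has_derivative F y) (at y within S)" using F(1) y at_eq[of U y] U by (metis IntD2)
      then show ?thesis using has_derivative_unique_approachable[OF S] f' y by blast
    qed
    then have "Ck_on k (S \<inter> U) (\<lambda>x. f' x v)" using F(2) by (auto intro: Ck_on_cong)
    then show "\<exists>U. open U \<and> x \<in> U \<and> Ck_on k (S \<inter> U) (\<lambda>x. f' x v)" using U by blast
  qed
  then show ?case unfolding Ck_on.simps by (intro exI[of _ f']) (use f' in blast)
qed

lemma smooth_on_cong: "smooth_on S f \<Longrightarrow> (\<And>x. x \<in> S \<Longrightarrow> f x = h x) \<Longrightarrow> smooth_on S h"
  unfolding smooth_on_def by (blast intro: Ck_on_cong)

lemma smooth_on_subset: "smooth_on S f \<Longrightarrow> T \<subseteq> S \<Longrightarrow> smooth_on T f"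
  unfolding smooth_on_def by (blast intro: Ck_on_subset)

lemma smooth_on_const: "smooth_on S (\<lambda>x. c)"
  unfolding smooth_on_def by (blast intro: Ck_on_const)

lemma smooth_on_add: "smooth_on S f \<Longrightarrow> smooth_on S h \<Longrightarrow> smooth_on S (\<lambda>x. f x + h x)"
  unfolding smooth_on_def by (blast intro: Ck_on_add)

lemma smooth_on_sum: "(\<And>i. i \<in> I \<Longrightarrow> smooth_on S (f i)) \<Longrightarrow> smooth_on S (\<lambda>x. \<Sum>i\<in>I. f i x)"
  unfolding smooth_on_def by (blast intro: Ck_on_sum)

lemma smooth_on_linear_comp: "bounded_linear L \<Longrightarrow> smooth_on S f \<Longrightarrow> smooth_on S (\<lambda>x. L (f x))"
  unfolding smooth_on_def by (blast intro: Ck_on_linear_comp)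

lemma smooth_on_bounded_linear: "bounded_linear L \<Longrightarrow> smooth_on S L"
  unfolding smooth_on_def by (blast intro: Ck_on_bounded_linear)

lemma smooth_on_mult:
  fixes f h :: "'e::euclidean_space \<Rightarrow> real"
  shows "smooth_on S f \<Longrightarrow> smooth_on S h \<Longrightarrow> smooth_on S (\<lambda>x. f x * h x)"
  unfolding smooth_on_def by (blast intro: Ck_on_mult)

lemma smooth_on_inverse:
  fixes f :: "'e::euclidean_space \<Rightarrow> real"
  shows "smooth_on S f \<Longrightarrow> (\<And>x. x \<in> S \<Longrightarrow> f x \<noteq> 0) \<Longrightarrow> smooth_on S (\<lambda>x. inverse (f x))"
  unfolding smooth_on_def by (blast intro: Ck_on_inverse)

lemma smooth_on_compose:
  fixes h :: "'e::euclidean_space \<Rightarrow> real"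
  shows "smooth_on T h \<Longrightarrow> smooth_on S c \<Longrightarrow> c ` S \<subseteq> T \<Longrightarrow> smooth_on S (\<lambda>x. h (c x))"
  unfolding smooth_on_def by (blast intro: Ck_on_compose)

lemma smooth_on_imp_continuous_on: "smooth_on S f \<Longrightarrow> continuous_on S f"
  unfolding smooth_on_def using Ck_on.simps(1) by blast

lemma smooth_on_diff:
  fixes f h :: "'e::euclidean_space \<Rightarrow> real"
  shows "smooth_on S f \<Longrightarrow> smooth_on S h \<Longrightarrow> smooth_on S (\<lambda>x. f x - h x)"
  using smooth_on_add[of S f "\<lambda>x. (-1) * h x"] smooth_on_mult[OF smooth_on_const, of S h "-1"] by simp

lemma at_within_approachable_nontrivial:
  fixes J :: "real set"
  assumes "approachable J" "t \<in> J"
  shows "at t within J \<noteq> bot"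
proof -
  have "t islimpt J"
    unfolding islimpt_approachable
  proof (intro allI impI)
    fix e :: real assume "0 < e"
    then obtain d where "0 < \<bar>d\<bar>" "\<bar>d\<bar> < e" "t + d \<in> J"
      using assms(1)[unfolded approachable_def, rule_format, OF assms(2), of 1 e] by auto
    then show "\<exists>x'\<in>J. x' \<noteq> t \<and> dist x' t < e"
      by (intro bexI[of _ "t + d"]) (auto simp: dist_real_def)
  qed
  then show ?thesis by (simp add: trivial_limit_within)
qed

lemma vector_derivative_eqI:
  fixes J :: "real set"
  assumes "approachable J" "t \<in> J" "(f has_vector_derivative y) (at t within J)"
  shows "vector_derivative f (at t within J) = y"
  using assms at_within_approachable_nontrivial vector_derivative_within by blast

lemma smooth_on_has_vector_derivative:
  fixes f :: "real \<Rightarrow> real"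
  assumes "smooth_on J f" "t \<in> J"
  shows "(f has_vector_derivative vector_derivative f (at t within J)) (at t within J)"
proof -
  have "Ck_on (Suc 0) J f" using assms unfolding smooth_on_def by blast
  then show ?thesis using assms(2) unfolding vector_derivative_works[symmetric]
    by (auto simp: differentiable_def)
qed

lemma smooth_on_vector_derivative:
  fixes f :: "real \<Rightarrow> real"
  assumes J: "approachable J" and f: "smooth_on J f"
  shows "smooth_on J (\<lambda>t. vector_derivative f (at t within J))"
  unfolding smooth_on_def
proof
  fix k
  have "Ck_on (Suc k) J f" using f unfolding smooth_on_def by blast
  then obtain f' where f': "\<forall>x\<in>J. (f has_derivative f' x) (at x within J)"
    "\<forall>v. Ck_on k J (\<lambda>x. f' x v)" by auto
  have "f' t 1 = vector_derivative f (at t within J)" if t: "t \<in> J" for t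
  proof -
    have d: "(f has_derivative f' t) (at t within J)" using f' t by blast
    have "f' t h = h *\<^sub>R f' t 1" for h
      using linear_cmul[OF has_derivative_linear[OF d], of h 1] by simp
    then have "f' t = (\<lambda>h. h *\<^sub>R f' t 1)" by (rule ext)
    then have "(f has_vector_derivative f' t 1) (at t within J)"
      unfolding has_vector_derivative_def by (rule has_derivative_eq_rhs[OF d])
    then show ?thesis by (rule vector_derivative_eqI[OF J t, symmetric])
  qed
  then show "Ck_on k J (\<lambda>t. vector_derivative f (at t within J))"
    by (intro Ck_on_cong[OF f'(2)[rule_format, of 1]])
qed

section \<open>Local smoothness\<close>

text \<open>
  Quotients and solutions of linear systems are smooth only where a denominator does not vanish, so
  such arguments are carried out near one point; \<open>smooth_on_local\<close> then globalizes them.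
\<close>

definition smooth_near ::
  "'e::euclidean_space set \<Rightarrow> 'e \<Rightarrow> ('e \<Rightarrow> 'f::euclidean_space) \<Rightarrow> bool" where
  "smooth_near S x f \<longleftrightarrow> (\<exists>U. open U \<and> x \<in> U \<and> smooth_on (S \<inter> U) f)"

lemma smooth_on_imp_near: "smooth_on S f \<Longrightarrow> smooth_near S x f"
  unfolding smooth_near_def by (rule exI[of _ UNIV]) auto

lemma smooth_on_local:
  assumes "approachable S" "\<And>x. x \<in> S \<Longrightarrow> smooth_near S x f"
  shows "smooth_on S f"
  unfolding smooth_on_def
proof
  fix k
  show "Ck_on k S f"
  proof (rule Ck_on_local[OF assms(1)])
    fix x assume "x \<in> S"
    then show "\<exists>U. open U \<and> x \<in> U \<and> Ck_on k (S \<inter> U) f"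
      using assms(2) unfolding smooth_on_def smooth_near_def by blast
  qed
qed

lemma smooth_near_cong:
  assumes "smooth_near S x f" "open N" "x \<in> N" "\<And>y. y \<in> S \<inter> N \<Longrightarrow> f y = h y"
  shows "smooth_near S x h"
proof -
  obtain U where U: "open U" "x \<in> U" "smooth_on (S \<inter> U) f"
    using assms(1) unfolding smooth_near_def by blast
  have "smooth_on (S \<inter> (U \<inter> N)) f" by (rule smooth_on_subset[OF U(3)]) blast
  then have "smooth_on (S \<inter> (U \<inter> N)) h" by (rule smooth_on_cong) (use assms(4) in blast)
  moreover have "open (U \<inter> N)" "x \<in> U \<inter> N" using U assms(2,3) by auto
  ultimately show ?thesis unfolding smooth_near_def by blast
qed

lemma smooth_near_binop:
  assumes "smooth_near S x f" "smooth_near S x h"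
    "\<And>T. T \<subseteq> S \<Longrightarrow> smooth_on T f \<Longrightarrow> smooth_on T h \<Longrightarrow> smooth_on T F"
  shows "smooth_near S x F"
proof -
  obtain U W where "open U" "x \<in> U" "smooth_on (S \<inter> U) f" "open W" "x \<in> W" "smooth_on (S \<inter> W) h"
    using assms(1,2) unfolding smooth_near_def by blast
  then have "smooth_on (S \<inter> (U \<inter> W)) f" "smooth_on (S \<inter> (U \<inter> W)) h"
      "open (U \<inter> W)" "x \<in> U \<inter> W"
    using smooth_on_subset[of "S \<inter> U" f "S \<inter> (U \<inter> W)"]
      smooth_on_subset[of "S \<inter> W" h "S \<inter> (U \<inter> W)"] by auto
  then show ?thesis unfolding smooth_near_def using assms(3)[of "S \<inter> (U \<inter> W)"] by blast
qed

lemma smooth_near_add: "smooth_near S x f \<Longrightarrow> smooth_near S x h \<Longrightarrow> smooth_near S x (\<lambda>x. f x + h x)"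
  by (erule (1) smooth_near_binop) (rule smooth_on_add)

lemma smooth_near_diff:
  fixes f h :: "'e::euclidean_space \<Rightarrow> real"
  shows "smooth_near S x f \<Longrightarrow> smooth_near S x h \<Longrightarrow> smooth_near S x (\<lambda>x. f x - h x)"
  by (erule (1) smooth_near_binop) (rule smooth_on_diff)

lemma smooth_near_mult:
  fixes f h :: "'e::euclidean_space \<Rightarrow> real"
  shows "smooth_near S x f \<Longrightarrow> smooth_near S x h \<Longrightarrow> smooth_near S x (\<lambda>x. f x * h x)"
  by (erule (1) smooth_near_binop) (rule smooth_on_mult)

lemma smooth_near_sum:
  "(\<And>i. i \<in> I \<Longrightarrow> smooth_near S x (f i)) \<Longrightarrow> smooth_near S x (\<lambda>x. \<Sum>i\<in>I. f i x)"
  by (induction I rule: infinite_finite_induct)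
     (auto intro: smooth_near_add smooth_on_imp_near[OF smooth_on_const])

lemma smooth_near_nonzero:
  fixes f :: "'e::euclidean_space \<Rightarrow> real"
  assumes "smooth_near S x f" "x \<in> S" "f x \<noteq> 0"
  obtains U where "open U" "x \<in> U" "smooth_on (S \<inter> U) f" "\<And>y. y \<in> S \<inter> U \<Longrightarrow> f y \<noteq> 0"
proof -
  obtain U where U: "open U" "x \<in> U" "smooth_on (S \<inter> U) f" using assms unfolding smooth_near_def by auto
  then have "continuous_on (S \<inter> U) f" by (blast intro: smooth_on_imp_continuous_on)
  then obtain W where W: "open W" "W \<inter> (S \<inter> U) = f -` (- {0}) \<inter> (S \<inter> U)"
    by (metis continuous_on_open_invariant open_Compl closed_singleton)
  show ?thesis
  proof (rule that[of "U \<inter> W"])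
    show "open (U \<inter> W)" using U W by auto
    show "x \<in> U \<inter> W" using U W assms by auto
    show "smooth_on (S \<inter> (U \<inter> W)) f" using U by (auto intro: smooth_on_subset)
    show "\<And>y. y \<in> S \<inter> (U \<inter> W) \<Longrightarrow> f y \<noteq> 0" using W by auto
  qed
qed

lemma smooth_near_divide:
  fixes f h :: "'e::euclidean_space \<Rightarrow> real"
  assumes "smooth_near S x f" "smooth_near S x h" "x \<in> S" "h x \<noteq> 0"
  shows "smooth_near S x (\<lambda>x. f x / h x)"
proof -
  obtain U where U: "open U" "x \<in> U" "smooth_on (S \<inter> U) h" "\<And>y. y \<in> S \<inter> U \<Longrightarrow> h y \<noteq> 0"
    using smooth_near_nonzero assms by metis
  then have "smooth_near S x (\<lambda>x. inverse (h x))"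
    unfolding smooth_near_def by (blast intro: smooth_on_inverse)
  then show ?thesis using smooth_near_mult[OF assms(1)] by (simp add: divide_inverse)
qed

section \<open>Bump functions\<close>

text \<open>
  The derivative of \<open>flat n\<close> is a linear combination of \<open>flat (n + 1)\<close> and \<open>flat (n + 2)\<close>, so all
  derivatives of \<open>flat 0\<close>, which vanishes to infinite order at zero, stay in the span of this family.
\<close>

definition flat :: "nat \<Rightarrow> real \<Rightarrow> real" where
  "flat n x = (if 0 < x then (1 / x) ^ n * exp (- (1 / x)) else 0)"

lemma flat_tendsto_0: "(flat n \<longlongrightarrow> 0) (at 0)"
proof -
  have "((\<lambda>x::real. (1 / x) ^ n * exp (- (1 / x))) \<longlongrightarrow> 0) (at_right 0)"
  proof -
    have "((\<lambda>y::real. y ^ n / exp y) \<longlongrightarrow> 0) at_top" by (rule tendsto_power_div_exp_0)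
    from filterlim_compose[OF this filterlim_inverse_at_top_right] show ?thesis
      by (simp add: divide_inverse exp_minus)
  qed
  moreover have "eventually (\<lambda>x. (1 / x) ^ n * exp (- (1 / x)) = flat n x) (at_right 0)"
    unfolding eventually_at_filter by (auto simp: flat_def)
  ultimately have "(flat n \<longlongrightarrow> 0) (at_right 0)" by (rule Lim_transform_eventually)
  moreover have "(flat n \<longlongrightarrow> 0) (at_left 0)"
    by (rule Lim_transform_eventually[OF tendsto_const[of 0]])
       (auto simp: eventually_at_filter flat_def)
  ultimately show ?thesis by (simp add: filterlim_split_at)
qed

text \<open>
  Away from zero this is the product rule; at zero the difference quotient of \<open>flat n\<close> is
  \<open>flat (Suc n)\<close>.
\<close>

lemma flat_has_derivative:
  "(flat n has_field_derivative flat (n + 2) x - of_nat n * flat (n + 1) x) (at x)"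
proof -
  consider "x < 0" | "x = 0" | "x > 0" by linarith
  then show ?thesis
  proof cases
    case 1
    have "(flat n has_field_derivative 0) (at x)"
      by (rule has_field_derivative_transform_within_open[of "\<lambda>_. 0" _ _ "{..<0}"])
         (use 1 in \<open>auto simp: flat_def\<close>)
    then show ?thesis using 1 by (simp add: flat_def)
  next
    case 2
    have "(\<lambda>h. (flat n (0 + h) - flat n 0) / h) = flat (n + 1)"
      by (auto simp: flat_def fun_eq_iff)
    then have "(\<lambda>h. (flat n (0 + h) - flat n 0) / h) \<midarrow>0\<rightarrow> 0"
      using flat_tendsto_0 by metis
    then have "(flat n has_field_derivative 0) (at 0)" unfolding DERIV_def .
    then show ?thesis using 2 by (simp add: flat_def)
  next
    case 3
    define y where "y = 1 / x"
    have dy: "((\<lambda>x. 1 / x) has_field_derivative - (y * y)) (at x)"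
      unfolding y_def by (rule derivative_eq_intros refl)+ (use 3 in auto)
    have "flat (n + 2) x - of_nat n * flat (n + 1) x
        = (y ^ n * y * y - of_nat n * y ^ n * y) * exp (- y)"
      using 3 by (simp add: flat_def y_def[symmetric] algebra_simps)
    also have "\<dots> = of_nat n * (- (y * y) * y ^ (n - Suc 0)) * exp (- y)
        + exp (- y) * - (- (y * y)) * y ^ n"
      by (cases n) (simp_all add: algebra_simps)
    finally have "((\<lambda>x. (1 / x) ^ n * exp (- (1 / x))) has_field_derivative
        (flat (n + 2) x - of_nat n * flat (n + 1) x)) (at x)"
      using DERIV_mult[OF DERIV_power[OF dy, of n] DERIV_fun_exp[OF DERIV_minus[OF dy]]]
      by (simp only: y_def)
    then show ?thesis
      by (rule has_field_derivative_transform_within_open[of _ _ _ "{0<..}"])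
         (use 3 in \<open>auto simp: flat_def\<close>)
  qed
qed

lemma Ck_on_flat: "Ck_on k UNIV (flat n)"
proof (induction k arbitrary: n)
  case 0
  show ?case
    using flat_has_derivative DERIV_isCont continuous_at_imp_continuous_on
    by (metis Ck_on.simps(1))
next
  case (Suc k)
  have "Ck_on k UNIV (\<lambda>x. v * flat (n + 2) x + (- (v * of_nat n)) * flat (n + 1) x)" for v
    by (intro Ck_on_add Ck_on_mult Ck_on_const Suc.IH)
  then have "Ck_on k UNIV (\<lambda>x. (flat (n + 2) x - of_nat n * flat (n + 1) x) * v)" for v
    by (rule Ck_on_cong) (simp add: algebra_simps)
  then show ?case unfolding Ck_on.simps
    by (intro exI[of _ "\<lambda>x. (*) (flat (n + 2) x - of_nat n * flat (n + 1) x)"])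
       (use flat_has_derivative[unfolded has_field_derivative_def] in blast)
qed

text \<open>
  The polynomial \<open>r\<^sup>2 - (norm (x - c))\<^sup>2\<close> is positive exactly on the open ball, and \<open>flat 0\<close> is
  positive exactly at positive arguments.
\<close>

lemma smooth_cutoff_exists:
  fixes c :: "'e::euclidean_space"
  assumes "0 < r"
  obtains w :: "'e \<Rightarrow> real" where "smooth_on UNIV w" "w c \<noteq> 0" "\<And>x. x \<notin> cball c r \<Longrightarrow> w x = 0"
proof
  let ?s = "\<lambda>x::'e. r\<^sup>2 + (\<Sum>b\<in>Basis. (-1) * (((x \<bullet> b) + (- (c \<bullet> b))) * ((x \<bullet> b) + (- (c \<bullet> b)))))"
  have s: "?s x = r\<^sup>2 - (norm (x - c))\<^sup>2" for x
    unfolding power2_norm_eq_inner euclidean_inner[of "x - c" "x - c"]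
    by (simp add: inner_diff_left sum_negf)
  have "smooth_on UNIV ?s"
    by (intro smooth_on_add smooth_on_sum smooth_on_mult smooth_on_const
        smooth_on_bounded_linear bounded_linear_inner_left)
  then show "smooth_on UNIV (\<lambda>x. flat 0 (?s x))"
    using smooth_on_compose[of UNIV "flat 0" UNIV ?s] Ck_on_flat by (auto simp: smooth_on_def)
  show "flat 0 (?s c) \<noteq> 0" unfolding s using assms by (simp add: flat_def)
  fix x assume "x \<notin> cball c r"
  then have "r\<^sup>2 \<le> (norm (x - c))\<^sup>2"
    using assms by (intro power_mono) (auto simp: dist_norm norm_minus_commute)
  then show "flat 0 (?s x) = 0" unfolding s by (simp add: flat_def)
qed

section \<open>Charts and curves\<close>

lemma smooth_atlas_chart:
  assumes "smooth_atlas A" "(U, \<phi>) \<in> A"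
  shows "open U" "open (\<phi> ` U)" "homeomorphism U (\<phi> ` U) \<phi> (inv_into U \<phi>)"
    and "continuous_on U \<phi>" "continuous_on (\<phi> ` U) (inv_into U \<phi>)"
    and "\<And>q. q \<in> U \<Longrightarrow> inv_into U \<phi> (\<phi> q) = q"
    and "\<And>x. x \<in> \<phi> ` U \<Longrightarrow> inv_into U \<phi> x \<in> U \<and> \<phi> (inv_into U \<phi> x) = x"
proof -
  show 1: "open U" "open (\<phi> ` U)" "homeomorphism U (\<phi> ` U) \<phi> (inv_into U \<phi>)"
    using assms unfolding smooth_atlas_def by blast+
  show "continuous_on U \<phi>" "continuous_on (\<phi> ` U) (inv_into U \<phi>)"
    "\<And>q. q \<in> U \<Longrightarrow> inv_into U \<phi> (\<phi> q) = q"
    "\<And>x. x \<in> \<phi> ` U \<Longrightarrow> inv_into U \<phi> x \<in> U \<and> \<phi> (inv_into U \<phi> x) = x"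
    using 1(3) unfolding homeomorphism_def by (auto simp: inv_into_into f_inv_into_f)
qed

lemma smooth_atlas_covers:
  assumes "smooth_atlas A" obtains U \<phi> where "(U, \<phi>) \<in> A" "p \<in> U"
proof -
  have "p \<in> (\<Union>(U, \<phi>)\<in>A. U)" using assms unfolding smooth_atlas_def by simp
  then show ?thesis using that by auto
qed

lemma smooth_atlas_transition:
  assumes "smooth_atlas A" "(U, \<phi>) \<in> A" "(W, \<psi>) \<in> A"
  shows "smooth_on (\<phi> ` (U \<inter> W)) (\<lambda>x. \<psi> (inv_into U \<phi> x))"
proof -
  have "\<forall>(U, \<phi>)\<in>A. \<forall>(V, \<psi>)\<in>A. smooth_on (\<phi> ` (U \<inter> V)) (\<psi> \<circ> inv_into U \<phi>)"
    using assms(1) unfolding smooth_atlas_def by simp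
  from bspec[OF bspec[OF this assms(2), unfolded prod.case] assms(3)] show ?thesis
    by (simp add: o_def)
qed

lemma open_chart_image:
  assumes "smooth_atlas A" "(U, \<phi>) \<in> A" "open N"
  shows "open (\<phi> ` (U \<inter> N))"
proof -
  note c = smooth_atlas_chart[OF assms(1,2)]
  have "openin (top_of_set (\<phi> ` U)) (\<phi> ` (U \<inter> N))"
    by (rule homeomorphism_imp_open_map[OF c(3)]) (use assms(3) in auto)
  then show ?thesis using c(2) openin_open_eq by blast
qed

lemma smooth_funs_chart:
  "f \<in> smooth_funs A \<Longrightarrow> (U, \<phi>) \<in> A \<Longrightarrow> smooth_on (\<phi> ` U) (\<lambda>x. f (inv_into U \<phi> x))"
  unfolding smooth_funs_def o_def by blast

lemma smooth_funs_const: "(\<lambda>_. c) \<in> smooth_funs A"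
  unfolding smooth_funs_def o_def by (auto intro: smooth_on_const)

lemma smooth_funs_add:
  "f \<in> smooth_funs A \<Longrightarrow> h \<in> smooth_funs A \<Longrightarrow> (\<lambda>p. f p + h p) \<in> smooth_funs A"
  unfolding smooth_funs_def o_def by (auto intro: smooth_on_add)

lemma smooth_funs_mult:
  "f \<in> smooth_funs A \<Longrightarrow> h \<in> smooth_funs A \<Longrightarrow> (\<lambda>p. f p * h p) \<in> smooth_funs A"
  unfolding smooth_funs_def o_def by (auto intro: smooth_on_mult)

text \<open>
  The image of the closed ball in the manifold is compact, hence closed because the manifold is
  Hausdorff. Its complement is therefore open, and together with \<open>U\<close> it covers the manifold; the
  function is a composition with a transition map on the one and zero on the other.
\<close>

lemma smooth_funs_extend_by_0:
  fixes A :: "('a::{t2_space, second_countable_topology}, 'e::euclidean_space) chart set"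
  assumes A: "smooth_atlas A" and U: "(U, \<phi>) \<in> A"
    and w: "smooth_on UNIV w" "\<And>x. x \<notin> cball c r \<Longrightarrow> w x = 0" and r: "cball c r \<subseteq> \<phi> ` U"
  shows "(\<lambda>q. if q \<in> U then w (\<phi> q) else 0) \<in> smooth_funs A"
  unfolding smooth_funs_def
proof clarify
  fix W and \<psi> :: "'a \<Rightarrow> 'e" assume W: "(W, \<psi>) \<in> A"
  note u = smooth_atlas_chart[OF A U] and v = smooth_atlas_chart[OF A W]
  define F where "F = (\<lambda>q. if q \<in> U then w (\<phi> q) else 0)"
  define K where "K = inv_into U \<phi> ` cball c r"
  have "compact K" unfolding K_def
    by (rule compact_continuous_image) (use r u(5) in \<open>auto intro: continuous_on_subset\<close>)
  then have K: "open (- K)" by (simp add: compact_imp_closed open_Compl)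
  have KU: "K \<subseteq> U" using r u(7) by (auto simp: K_def)
  have F0: "F q = 0" if "q \<notin> K" for q
  proof (cases "q \<in> U")
    case True
    then have "\<phi> q \<notin> cball c r" using that u(6) unfolding K_def by (metis imageI)
    then show ?thesis using w(2) by (simp add: F_def)
  qed (simp add: F_def)
  have "smooth_on (\<psi> ` W) (\<lambda>x. F (inv_into W \<psi> x))"
  proof (rule smooth_on_local[OF approachable_open[OF v(2)]])
    fix x assume x: "x \<in> \<psi> ` W"
    show "smooth_near (\<psi> ` W) x (\<lambda>x. F (inv_into W \<psi> x))"
    proof (cases "inv_into W \<psi> x \<in> U")
      case True
      have "smooth_on (\<psi> ` (W \<inter> U)) (\<lambda>y. w (\<phi> (inv_into W \<psi> y)))"
        by (rule smooth_on_compose[OF w(1) smooth_atlas_transition[OF A W U]]) auto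
      then have "smooth_on (\<psi> ` (W \<inter> U)) (\<lambda>y. F (inv_into W \<psi> y))"
        by (rule smooth_on_cong) (use v(6) in \<open>auto simp: F_def\<close>)
      then have "smooth_on (\<psi> ` W \<inter> \<psi> ` (W \<inter> U)) (\<lambda>y. F (inv_into W \<psi> y))"
        by (rule smooth_on_subset) blast
      moreover have "x \<in> \<psi> ` (W \<inter> U)" using True v(7)[OF x] by (metis IntI imageI)
      ultimately show ?thesis unfolding smooth_near_def
        using open_chart_image[OF A W u(1)] by blast
    next
      case False
      then have "inv_into W \<psi> x \<notin> K" using KU by blast
      then have "x \<in> \<psi> ` (W \<inter> - K)" using v(7)[OF x] by (metis ComplI IntI imageI)
      moreover have "F (inv_into W \<psi> y) = 0" if "y \<in> \<psi> ` (W \<inter> - K)" for y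
        using that F0 v(6) by auto
      ultimately show ?thesis
        by (intro smooth_near_cong[OF smooth_on_imp_near[OF smooth_on_const[of _ 0]]
              open_chart_image[OF A W K]]) auto
    qed
  qed
  then show "smooth_on (\<psi> ` W) ((\<lambda>q. if q \<in> U then w (\<phi> q) else 0) \<circ> inv_into W \<psi>)"
    by (simp add: F_def o_def)
qed

text \<open>
  Smooth functions are defined on the whole manifold, so the coordinates of a chart need not
  be among them. Near \<open>p\<close> they are the quotients of the smooth functions \<open>\<rho> * (\<phi> \<bullet> b)\<close> and \<open>\<rho>\<close>.
\<close>

lemma chart_cutoff_exists:
  fixes A :: "('a::{t2_space, second_countable_topology}, 'e::euclidean_space) chart set"
  assumes A: "smooth_atlas A" and U: "(U, \<phi>) \<in> A" and p: "p \<in> U"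
  obtains \<rho> where "\<rho> \<in> smooth_funs A" "\<rho> p \<noteq> 0"
    "\<And>b. (\<lambda>q. \<rho> q * (\<phi> q \<bullet> b)) \<in> smooth_funs A"
proof -
  note u = smooth_atlas_chart[OF A U]
  obtain r where r: "r > 0" "cball (\<phi> p) r \<subseteq> \<phi> ` U"
    using u(2) p open_contains_cball by (metis imageI)
  obtain w :: "'e \<Rightarrow> real" where w: "smooth_on UNIV w" "w (\<phi> p) \<noteq> 0"
    "\<And>x. x \<notin> cball (\<phi> p) r \<Longrightarrow> w x = 0"
    using smooth_cutoff_exists[OF r(1)] by metis
  define \<rho> where "\<rho> = (\<lambda>q. if q \<in> U then w (\<phi> q) else 0)"
  show ?thesis
  proof (rule that)
    show "\<rho> \<in> smooth_funs A" unfolding \<rho>_def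
      by (rule smooth_funs_extend_by_0[OF A U w(1,3) r(2)])
    show "\<rho> p \<noteq> 0" using p w(2) by (simp add: \<rho>_def)
    fix b
    have "smooth_on UNIV (\<lambda>x. w x * (x \<bullet> b))"
      by (intro smooth_on_mult w(1) smooth_on_bounded_linear bounded_linear_inner_left)
    then have "(\<lambda>q. if q \<in> U then w (\<phi> q) * (\<phi> q \<bullet> b) else 0) \<in> smooth_funs A"
      by (rule smooth_funs_extend_by_0[OF A U _ _ r(2)]) (use w(3) in auto)
    moreover have "(\<lambda>q. \<rho> q * (\<phi> q \<bullet> b)) = (\<lambda>q. if q \<in> U then w (\<phi> q) * (\<phi> q \<bullet> b) else 0)"
      by (auto simp: \<rho>_def)
    ultimately show "(\<lambda>q. \<rho> q * (\<phi> q \<bullet> b)) \<in> smooth_funs A" by simp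
  qed
qed

lemma curve_preimage_open:
  assumes "continuous_on J \<gamma>" "open U"
  obtains N where "open N" "{t\<in>J. \<gamma> t \<in> U} = J \<inter> N" "\<And>t. t \<in> J \<Longrightarrow> t \<in> N \<longleftrightarrow> \<gamma> t \<in> U"
proof -
  obtain N where "open N" "N \<inter> J = \<gamma> -` U \<inter> J" using assms by (metis continuous_on_open_invariant)
  then show ?thesis by (intro that[of N]) auto
qed

lemma smooth_curve_comp:
  assumes A: "smooth_atlas A" and J: "approachable J"
    and \<gamma>: "smooth_curve A J \<gamma>" and f: "f \<in> smooth_funs A"
  shows "smooth_on J (\<lambda>t. f (\<gamma> t))"
proof (rule smooth_on_local[OF J])
  fix t assume t: "t \<in> J"
  obtain U \<phi> where U: "(U, \<phi>) \<in> A" "\<gamma> t \<in> U" using smooth_atlas_covers[OF A] by metis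
  note u = smooth_atlas_chart[OF A U(1)]
  obtain N where N: "open N" "{t\<in>J. \<gamma> t \<in> U} = J \<inter> N" "\<And>t. t \<in> J \<Longrightarrow> t \<in> N \<longleftrightarrow> \<gamma> t \<in> U"
    using \<gamma> unfolding smooth_curve_def by (blast intro: curve_preimage_open[OF _ u(1), of J \<gamma>])
  have "smooth_on (J \<inter> N) (\<lambda>t. \<phi> (\<gamma> t))"
    using \<gamma> U(1) N(2) unfolding smooth_curve_def o_def by fastforce
  then have "smooth_on (J \<inter> N) (\<lambda>t. f (inv_into U \<phi> (\<phi> (\<gamma> t))))"
    by (rule smooth_on_compose[OF smooth_funs_chart[OF f U(1)]]) (use N(3) in blast)
  then have "smooth_on (J \<inter> N) (\<lambda>t. f (\<gamma> t))"
    by (rule smooth_on_cong) (use N(3) u(6) in auto)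
  then show "smooth_near J t (\<lambda>t. f (\<gamma> t))"
    unfolding smooth_near_def using N t U(2) by blast
qed

text \<open>
  Global smooth functions detect smoothness of a curve: in a chart, each coordinate of the curve is
  locally a quotient of two global smooth functions along the curve, by \<open>chart_cutoff_exists\<close>.
\<close>

lemma smooth_curveI:
  assumes A: "smooth_atlas A" and J: "approachable J" and c: "continuous_on J \<gamma>"
    and f: "\<And>f. f \<in> smooth_funs A \<Longrightarrow> smooth_on J (\<lambda>t. f (\<gamma> t))"
  shows "smooth_curve A J \<gamma>"
  unfolding smooth_curve_def
proof (intro conjI c, clarify)
  fix U \<phi> assume U: "(U, \<phi>) \<in> A"
  note u = smooth_atlas_chart[OF A U(1)]
  obtain N where N: "open N" "{t\<in>J. \<gamma> t \<in> U} = J \<inter> N" "\<And>t. t \<in> J \<Longrightarrow> t \<in> N \<longleftrightarrow> \<gamma> t \<in> U"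
    using curve_preimage_open[OF c u(1)] by blast
  have "smooth_on (J \<inter> N) (\<lambda>t. \<phi> (\<gamma> t))"
  proof (rule smooth_on_local[OF approachable_Int_open[OF J N(1)]])
    fix t assume t: "t \<in> J \<inter> N"
    then have tU: "\<gamma> t \<in> U" using N(3) by blast
    obtain \<rho> where \<rho>: "\<rho> \<in> smooth_funs A" "\<rho> (\<gamma> t) \<noteq> 0"
      "\<And>b. (\<lambda>q. \<rho> q * (\<phi> q \<bullet> b)) \<in> smooth_funs A"
      using chart_cutoff_exists[OF A U tU] by metis
    have near: "smooth_near (J \<inter> N) t (\<lambda>s. h (\<gamma> s))" if "h \<in> smooth_funs A" for h
      using smooth_on_imp_near[OF smooth_on_subset[OF f[OF that]]] by blast
    obtain M where M: "open M" "t \<in> M" "\<And>s. s \<in> (J \<inter> N) \<inter> M \<Longrightarrow> \<rho> (\<gamma> s) \<noteq> 0"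
      using smooth_near_nonzero[OF near[OF \<rho>(1)] t \<rho>(2)] by metis
    have comp: "smooth_near (J \<inter> N) t (\<lambda>s. \<phi> (\<gamma> s) \<bullet> b)" for b
    proof -
      have "smooth_near (J \<inter> N) t (\<lambda>s. \<rho> (\<gamma> s) * (\<phi> (\<gamma> s) \<bullet> b) / \<rho> (\<gamma> s))"
        by (rule smooth_near_divide[OF near[OF \<rho>(3)] near[OF \<rho>(1)] t \<rho>(2)])
      then show ?thesis by (rule smooth_near_cong[OF _ M(1,2)]) (use M(3) in auto)
    qed
    have "smooth_near (J \<inter> N) t (\<lambda>s. (\<phi> (\<gamma> s) \<bullet> b) *\<^sub>R b)" for b
      using comp[of b] unfolding smooth_near_def
      by (auto intro: smooth_on_linear_comp[OF bounded_linear_scaleR_left])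
    then have "smooth_near (J \<inter> N) t (\<lambda>s. \<Sum>b\<in>Basis. (\<phi> (\<gamma> s) \<bullet> b) *\<^sub>R b)"
      by (rule smooth_near_sum)
    then show "smooth_near (J \<inter> N) t (\<lambda>s. \<phi> (\<gamma> s))" by (simp add: euclidean_representation)
  qed
  then show "smooth_on {t \<in> J. \<gamma> t \<in> U} (\<phi> \<circ> \<gamma>)" unfolding N(2) by (simp add: o_def)
qed

lemma differentiable_curve_comp:
  assumes A: "smooth_atlas A" and \<gamma>: "differentiable_curve A J \<gamma>"
    and f: "f \<in> smooth_funs A" and t: "t \<in> J"
  shows "((\<lambda>t. f (\<gamma> t)) has_vector_derivative velocity A J \<gamma> t f) (at t within J)"
proof -
  obtain U \<phi> where U: "(U, \<phi>) \<in> A" "\<gamma> t \<in> U" using smooth_atlas_covers[OF A] by metis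
  note u = smooth_atlas_chart[OF A U(1)]
  obtain N where N: "open N" "{t\<in>J. \<gamma> t \<in> U} = J \<inter> N" "\<And>t. t \<in> J \<Longrightarrow> t \<in> N \<longleftrightarrow> \<gamma> t \<in> U"
    using \<gamma> unfolding differentiable_curve_def
    by (blast intro: curve_preimage_open[OF _ u(1), of J \<gamma>])
  have d1: "(\<phi> \<circ> \<gamma>) differentiable (at t within J)"
    using \<gamma> U t unfolding differentiable_curve_def by blast
  have "Ck_on (Suc 0) (\<phi> ` U) (\<lambda>x. f (inv_into U \<phi> x))"
    using smooth_funs_chart[OF f U(1)] unfolding smooth_on_def by blast
  then have "(\<lambda>x. f (inv_into U \<phi> x)) differentiable (at ((\<phi> \<circ> \<gamma>) t) within \<phi> ` U)"
    using U(2) by (auto simp: differentiable_def)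
  then have "(\<lambda>x. f (inv_into U \<phi> x)) differentiable (at ((\<phi> \<circ> \<gamma>) t))"
    using at_within_open[OF _ u(2), of "(\<phi> \<circ> \<gamma>) t"] U(2) by simp
  then have "(\<lambda>x. f (inv_into U \<phi> x)) differentiable (at ((\<phi> \<circ> \<gamma>) t) within (\<phi> \<circ> \<gamma>) ` J)"
    by (rule differentiable_at_withinI)
  from differentiable_chain_within[OF d1 this]
  obtain D where "((\<lambda>s. f (inv_into U \<phi> (\<phi> (\<gamma> s)))) has_derivative D) (at t within J)"
    by (auto simp: o_def differentiable_def)
  then have "((\<lambda>s. f (\<gamma> s)) has_derivative D) (at t within J)"
  proof (rule has_derivative_transform_eventually)
    show "eventually (\<lambda>s. f (inv_into U \<phi> (\<phi> (\<gamma> s))) = f (\<gamma> s)) (at t within J)"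
      unfolding eventually_at_topological using N(1) N(3) t U(2) u(6)
      by (intro exI[of _ N]) auto
  qed (use t U(2) u(6) in auto)
  then have "(\<lambda>s. f (\<gamma> s)) differentiable (at t within J)" by (auto simp: differentiable_def)
  then show ?thesis using f by (simp add: vector_derivative_works velocity_def o_def)
qed

text \<open>
  Bootstrapping: along the curve every smooth function \<open>f\<close> has the derivative \<open>Y f\<close>, which is again a
  smooth function along the curve, so \<open>f\<close> is differentiable to every order along it.
\<close>

lemma integral_curve_smooth:
  assumes A: "smooth_atlas A" and J: "approachable J"
    and Y: "Y \<in> vector_fields A" and \<gamma>: "integral_curve A Y J \<gamma>"
  shows "smooth_curve A J \<gamma>"
proof (rule smooth_curveI[OF A J])
  have d: "differentiable_curve A J \<gamma>" and v: "\<And>t. t \<in> J \<Longrightarrow> velocity A J \<gamma> t = Y (\<gamma> t)"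
    using \<gamma> unfolding integral_curve_def by auto
  show "continuous_on J \<gamma>" using d unfolding differentiable_curve_def by blast
  have der: "((\<lambda>t. f (\<gamma> t)) has_vector_derivative dir_deriv Y f (\<gamma> t)) (at t within J)"
    if "f \<in> smooth_funs A" "t \<in> J" for f t
    using differentiable_curve_comp[OF A d that] v[OF that(2)] by (simp add: dir_deriv_def)
  fix f assume "f \<in> smooth_funs A"
  then have "Ck_on k J (\<lambda>t. f (\<gamma> t))" for k
  proof (induction k arbitrary: f)
    case 0
    then show ?case using der
      by (auto simp: continuous_on_eq_continuous_within intro: has_vector_derivative_continuous)
  next
    case (Suc k)
    have "dir_deriv Y f \<in> smooth_funs A" using Y Suc.prems unfolding vector_fields_def by blast
    then have "Ck_on k J (\<lambda>t. v *\<^sub>R dir_deriv Y f (\<gamma> t))" for v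
      by (intro Ck_on_linear_comp[OF bounded_linear_scaleR_right] Suc.IH)
    then show ?case unfolding Ck_on.simps
      by (intro exI[of _ "\<lambda>t v. v *\<^sub>R dir_deriv Y f (\<gamma> t)"])
         (use der[OF Suc.prems, unfolded has_vector_derivative_def] in blast)
  qed
  then show "smooth_on J (\<lambda>t. f (\<gamma> t))" unfolding smooth_on_def by blast
qed

section \<open>Tangent vectors and vector fields\<close>

lemma sum_fun_apply: "(\<Sum>i\<in>I. F i) x = (\<Sum>i\<in>I. F i x)"
  by (induction I rule: infinite_finite_induct) auto

lemma subspace_tangent_space: "subspace (tangent_space A p)"
  unfolding subspace_def tangent_space_def
  by (auto simp: algebra_simps)

text \<open>
  The product rule for \<open>1 * 1 = 1\<close> shows that a derivation kills the constant \<open>1\<close>.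
\<close>

lemma tangent_space_const:
  assumes v: "v \<in> tangent_space A p"
  shows "v (\<lambda>_. c) = 0"
proof -
  let ?one = "\<lambda>_::'a. 1::real"
  have s: "?one \<in> smooth_funs A" by (rule smooth_funs_const)
  have "v (?one * ?one) = ?one p * v ?one + ?one p * v ?one"
    using v s unfolding tangent_space_def by blast
  moreover have "?one * ?one = ?one" by (simp add: fun_eq_iff)
  ultimately have "v ?one = 0" by simp
  moreover have "v (c *\<^sub>R ?one) = c * v ?one" using v s unfolding tangent_space_def by blast
  moreover have "c *\<^sub>R ?one = (\<lambda>_. c)" by (simp add: fun_eq_iff)
  ultimately show ?thesis by simp
qed

lemma vector_fields_tangent: "Y \<in> vector_fields A \<Longrightarrow> Y p \<in> tangent_space A p"
  unfolding vector_fields_def by blast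

lemma vector_fields_smooth: "Y \<in> vector_fields A \<Longrightarrow> f \<in> smooth_funs A \<Longrightarrow> dir_deriv Y f \<in> smooth_funs A"
  unfolding vector_fields_def by blast

lemma vector_fields_0: "0 \<in> vector_fields A"
  unfolding vector_fields_def
  by (auto simp: dir_deriv_def intro: subspace_0[OF subspace_tangent_space] smooth_funs_const)

lemma vector_fields_add: "Y \<in> vector_fields A \<Longrightarrow> Z \<in> vector_fields A \<Longrightarrow> Y + Z \<in> vector_fields A"
  unfolding vector_fields_def
  by (auto simp: dir_deriv_def intro: subspace_add[OF subspace_tangent_space] smooth_funs_add)

lemma vector_fields_fscale:
  "h \<in> smooth_funs A \<Longrightarrow> Y \<in> vector_fields A \<Longrightarrow> fscale h Y \<in> vector_fields A"
  unfolding vector_fields_def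
  by (auto simp: dir_deriv_def fscale_def
      intro: subspace_scale[OF subspace_tangent_space] smooth_funs_mult)

lemma vector_fields_sum:
  "(\<And>i. i \<in> I \<Longrightarrow> Z i \<in> vector_fields A) \<Longrightarrow> (\<Sum>i\<in>I. Z i) \<in> vector_fields A"
  by (induction I rule: infinite_finite_induct) (auto intro: vector_fields_0 vector_fields_add)

lemma sum_fscale_apply: "(\<Sum>i\<in>I. fscale (h i) (Z i)) p = (\<Sum>i\<in>I. h i p *\<^sub>R Z i p)"
  by (subst sum_fun_apply) (simp only: fscale_def)

lemma sum_fscale_add_apply:
  "(\<Sum>i\<in>I. fscale (h i) (Y i) + fscale (k i) (Z i)) p =
    (\<Sum>i\<in>I. h i p *\<^sub>R Y i p + k i p *\<^sub>R Z i p)"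
  by (subst sum_fun_apply, subst plus_fun_apply) (simp only: fscale_def)

lemma vector_fields_linear_combination:
  assumes "\<And>i. i \<in> I \<Longrightarrow> Z i \<in> vector_fields A"
  shows "(\<lambda>p. \<Sum>i\<in>I. c i *\<^sub>R Z i p) \<in> vector_fields A"
proof -
  have "(\<lambda>p. \<Sum>i\<in>I. c i *\<^sub>R Z i p) = (\<Sum>i\<in>I. fscale (\<lambda>_. c i) (Z i))"
    by (simp add: fun_eq_iff sum_fun_apply fscale_def)
  then show ?thesis
    using assms by (auto intro!: vector_fields_sum vector_fields_fscale smooth_funs_const)
qed

lemma span_image_sum:
  fixes f :: "'i \<Rightarrow> 'v::real_vector"
  assumes I: "finite I" and u: "u \<in> span (f ` I)"
  obtains c where "u = (\<Sum>i\<in>I. c i *\<^sub>R f i)"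
proof -
  have "\<exists>c. u = (\<Sum>i\<in>I. c i *\<^sub>R f i)" using u
  proof (induction rule: span_induct_alt)
    case base
    show ?case by (rule exI[of _ "\<lambda>_. 0"]) simp
  next
    case (step a x y)
    then obtain j c where j: "j \<in> I" "x = f j" and c: "y = (\<Sum>i\<in>I. c i *\<^sub>R f i)" by blast
    have "(\<Sum>i\<in>I. (if i = j then a else 0) *\<^sub>R f i) = (\<Sum>i\<in>I. if i = j then a *\<^sub>R f i else 0)"
      by (rule sum.cong) auto
    also have "\<dots> = a *\<^sub>R f j" using I j by simp
    finally have "a *\<^sub>R x + y = (\<Sum>i\<in>I. ((if i = j then a else 0) + c i) *\<^sub>R f i)"
      by (simp add: scaleR_add_left sum.distrib j c)
    then show ?case by (intro exI[of _ "\<lambda>i. (if i = j then a else 0) + c i"])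
  qed
  then show ?thesis using that by blast
qed

section \<open>Linear systems with smooth coefficients\<close>

text \<open>
  Gaussian elimination: if \<open>E (Suc n)\<close> does not vanish at time \<open>t\<close> on the test function \<open>f\<close>, then
  \<open>v (Suc n)\<close> can be solved for near \<open>t\<close> from the equation for \<open>f\<close>, and eliminating it leaves an
  independent system for the others.
\<close>

lemma smooth_near_coefficients:
  fixes v :: "nat \<Rightarrow> 'e::euclidean_space \<Rightarrow> real" and E :: "nat \<Rightarrow> 'e \<Rightarrow> 'b \<Rightarrow> real"
    and W :: "'e \<Rightarrow> 'b \<Rightarrow> real"
  assumes t: "t \<in> S"
  shows "\<lbrakk>\<And>i f. i \<in> {1..n} \<Longrightarrow> f \<in> F \<Longrightarrow> smooth_near S t (\<lambda>s. E i s f);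
    \<And>f. f \<in> F \<Longrightarrow> smooth_near S t (\<lambda>s. W s f);
    open N; t \<in> N; \<And>s f. s \<in> S \<inter> N \<Longrightarrow> f \<in> F \<Longrightarrow> W s f = (\<Sum>i=1..n. v i s * E i s f);
    \<And>c i. (\<And>f. f \<in> F \<Longrightarrow> (\<Sum>i=1..n. c i * E i t f) = 0) \<Longrightarrow> i \<in> {1..n} \<Longrightarrow> c i = 0;
    i \<in> {1..n}\<rbrakk> \<Longrightarrow> smooth_near S t (v i)"
proof (induction n arbitrary: E W N i)
  case 0
  then show ?case by simp
next
  case (Suc n)
  note E = Suc.prems(1) and W = Suc.prems(2) and eq = Suc.prems(5) and indep = Suc.prems(6)
  let ?M = "Suc n"
  have M: "?M \<in> {1..?M}" by simp
  have "\<exists>f\<in>F. E ?M t f \<noteq> 0"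
  proof (rule ccontr)
    assume "\<not> (\<exists>f\<in>F. E ?M t f \<noteq> 0)"
    then have "E ?M t f = 0" if "f \<in> F" for f using that by blast
    moreover have "(\<Sum>i=1..n. (if i = ?M then 1 else 0) * E i t f) = 0" for f
      by (rule sum.neutral) auto
    ultimately have "\<And>f. f \<in> F \<Longrightarrow> (\<Sum>i=1..?M. (if i = ?M then 1 else 0) * E i t f) = 0"
      by simp
    from indep[OF this M] show False by simp
  qed
  then obtain f where f: "f \<in> F" "E ?M t f \<noteq> 0" by blast
  obtain U where U: "open U" "t \<in> U" "\<And>s. s \<in> S \<inter> U \<Longrightarrow> E ?M s f \<noteq> 0"
    using smooth_near_nonzero[OF E[OF M f(1)] t f(2)] by blast
  define E' where "E' = (\<lambda>i s h. E i s h - E i s f / E ?M s f * E ?M s h)"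
  define W' where "W' = (\<lambda>s h. W s h - W s f / E ?M s f * E ?M s h)"
  have v: "smooth_near S t (v i)" if "i \<in> {1..n}" for i
  proof (rule Suc.IH[of E' W' "N \<inter> U"])
    show "smooth_near S t (\<lambda>s. E' i s h)" if "i \<in> {1..n}" "h \<in> F" for i h
      unfolding E'_def using that f M t
      by (intro smooth_near_diff smooth_near_mult smooth_near_divide E) auto
    show "smooth_near S t (\<lambda>s. W' s h)" if "h \<in> F" for h
      unfolding W'_def using that f M t
      by (intro smooth_near_diff smooth_near_mult smooth_near_divide E W) auto
    show "open (N \<inter> U)" "t \<in> N \<inter> U" using U Suc.prems(3,4) by auto
    show "W' s h = (\<Sum>i=1..n. v i s * E' i s h)" if s: "s \<in> S \<inter> (N \<inter> U)" and h: "h \<in> F" for s h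
    proof -
      have nz: "E ?M s f \<noteq> 0" using U(3) s by blast
      have "(\<Sum>i=1..n. v i s * E' i s h) =
          (\<Sum>i=1..n. v i s * E i s h) - (\<Sum>i=1..n. v i s * E i s f) / E ?M s f * E ?M s h"
        by (simp add: E'_def algebra_simps sum_subtractf sum_distrib_left sum_divide_distrib)
      moreover have "W s h = v ?M s * E ?M s h + (\<Sum>i=1..n. v i s * E i s h)"
        "W s f = v ?M s * E ?M s f + (\<Sum>i=1..n. v i s * E i s f)"
        using eq[of s h] eq[of s f] s h f(1) by simp_all
      ultimately show ?thesis using nz by (simp add: W'_def field_simps)
    qed
    show "c i = 0" if c: "\<And>h. h \<in> F \<Longrightarrow> (\<Sum>i=1..n. c i * E' i t h) = 0" and i: "i \<in> {1..n}" for c i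
    proof -
      \<comment> \<open>a relation among the reduced functionals lifts to one among all of them\<close>
      define d where "d = c(?M := - (\<Sum>i=1..n. c i * E i t f) / E ?M t f)"
      have d: "(\<Sum>i=1..n. d i * e i) = (\<Sum>i=1..n. c i * e i)" for e
        by (rule sum.cong) (auto simp: d_def)
      have "(\<Sum>i=1..?M. d i * E i t h) = 0" if h: "h \<in> F" for h
      proof -
        have "(\<Sum>i=1..?M. d i * E i t h) =
            - (\<Sum>i=1..n. c i * E i t f) / E ?M t f * E ?M t h + (\<Sum>i=1..n. c i * E i t h)"
          by (simp add: d) (simp add: d_def)
        also have "\<dots> = (\<Sum>i=1..n. c i * E' i t h)"
          by (simp add: E'_def algebra_simps sum_subtractf sum_distrib_left sum_divide_distrib)
        finally show ?thesis using c h by simp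
      qed
      then have "d i = 0" using indep[of d i] i by simp
      then show "c i = 0" using i by (simp add: d_def)
    qed
  qed (rule that)
  show ?case
  proof (cases "i = ?M")
    case True
    have "smooth_near S t (\<lambda>s. (W s f - (\<Sum>i=1..n. v i s * E i s f)) / E ?M s f)"
      using f M t by (intro smooth_near_divide smooth_near_diff smooth_near_sum smooth_near_mult E W v) auto
    then have "smooth_near S t (v ?M)"
    proof (rule smooth_near_cong)
      show "open (N \<inter> U)" "t \<in> N \<inter> U" using U Suc.prems(3,4) by auto
      show "(W s f - (\<Sum>i=1..n. v i s * E i s f)) / E ?M s f = v ?M s" if "s \<in> S \<inter> (N \<inter> U)" for s
        using eq[of s f] f(1) U(3)[of s] that by (simp add: field_simps)
    qed
    then show ?thesis using True by simp
  next
    case False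
    then show ?thesis using v Suc.prems(7) by auto
  qed
qed

section \<open>Orthonormal frames\<close>

text \<open>
  A global orthonormal frame turns vector fields, and vector fields along curves, into families of
  real functions. The left-invariant fields of a Lie group provide such a frame.
\<close>

locale orthonormal_frame =
  fixes A :: "('a::{t2_space, second_countable_topology}, 'e::euclidean_space) chart set"
    and g :: "'a \<Rightarrow> 'a tvec \<Rightarrow> 'a tvec \<Rightarrow> real"
    and nabla :: "'a vfield \<Rightarrow> 'a vfield \<Rightarrow> 'a vfield"
    and m :: nat
    and X :: "nat \<Rightarrow> 'a vfield"
  assumes atlas: "smooth_atlas A"
    and metric: "riemannian_metric A g"
    and connection: "levi_civita A g nabla"
    and frame_field: "i \<in> {1..m} \<Longrightarrow> X i \<in> vector_fields A"
    and orthonormal: "i \<in> {1..m} \<Longrightarrow> j \<in> {1..m} \<Longrightarrow> g p (X i p) (X j p) = (if i = j then 1 else 0)"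
    and spanning: "u \<in> tangent_space A p \<Longrightarrow> u \<in> span ((\<lambda>i. X i p) ` {1..m})"
begin

lemma frame_tangent: "i \<in> {1..m} \<Longrightarrow> X i p \<in> tangent_space A p"
  by (rule vector_fields_tangent[OF frame_field])

lemma g_sym: "u \<in> tangent_space A p \<Longrightarrow> v \<in> tangent_space A p \<Longrightarrow> g p u v = g p v u"
  and g_scale: "u \<in> tangent_space A p \<Longrightarrow> v \<in> tangent_space A p \<Longrightarrow> g p (c *\<^sub>R u) v = c * g p u v"
  and g_add: "u \<in> tangent_space A p \<Longrightarrow> v \<in> tangent_space A p \<Longrightarrow> w \<in> tangent_space A p
    \<Longrightarrow> g p (u + w) v = g p u v + g p w v"
  using metric unfolding riemannian_metric_def by simp_all

lemma g_smooth:
  "Y \<in> vector_fields A \<Longrightarrow> Z \<in> vector_fields A \<Longrightarrow> (\<lambda>p. g p (Y p) (Z p)) \<in> smooth_funs A"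
  using metric unfolding riemannian_metric_def by simp

lemma g_zero: "v \<in> tangent_space A p \<Longrightarrow> g p 0 v = 0"
  using g_scale[OF subspace_0[OF subspace_tangent_space], of v p 0] by simp

lemma g_sum:
  assumes u: "\<And>i. i \<in> I \<Longrightarrow> u i \<in> tangent_space A p" and v: "v \<in> tangent_space A p"
  shows "g p (\<Sum>i\<in>I. c i *\<^sub>R u i) v = (\<Sum>i\<in>I. c i * g p (u i) v)"
  using u
proof (induction I rule: infinite_finite_induct)
  case (insert i I)
  have "(\<Sum>i\<in>I. c i *\<^sub>R u i) \<in> tangent_space A p"
    using insert.prems by (auto intro!: subspace_sum subspace_scale subspace_tangent_space)
  moreover have i: "u i \<in> tangent_space A p" using insert.prems by blast
  moreover have "c i *\<^sub>R u i \<in> tangent_space A p"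
    by (rule subspace_scale[OF subspace_tangent_space i])
  ultimately have "g p (c i *\<^sub>R u i + (\<Sum>i\<in>I. c i *\<^sub>R u i)) v
      = c i * g p (u i) v + g p (\<Sum>i\<in>I. c i *\<^sub>R u i) v"
    using v by (simp only: g_add g_scale)
  moreover have "g p (\<Sum>i\<in>I. c i *\<^sub>R u i) v = (\<Sum>i\<in>I. c i * g p (u i) v)"
    using insert by blast
  ultimately show ?case by (simp only: sum.insert[OF insert.hyps])
qed (simp_all add: g_zero[OF v])

lemma g_diff:
  assumes "u \<in> tangent_space A p" "v \<in> tangent_space A p" "w \<in> tangent_space A p"
  shows "g p (u - w) v = g p u v - g p w v"
proof -
  have "u - w \<in> tangent_space A p" by (rule subspace_diff[OF subspace_tangent_space assms(1,3)])
  from g_add[OF this assms(2,3)] show ?thesis by simp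
qed

lemma g_frame_sum:
  assumes "K \<subseteq> {1..m}" "j \<in> {1..m}"
  shows "g p (\<Sum>i\<in>K. c i *\<^sub>R X i p) (X j p) = (if j \<in> K then c j else 0)"
proof -
  have "finite K" using assms finite_subset by blast
  have "g p (\<Sum>i\<in>K. c i *\<^sub>R X i p) (X j p) = (\<Sum>i\<in>K. c i * g p (X i p) (X j p))"
    by (rule g_sum) (use assms frame_tangent in auto)
  also have "\<dots> = (\<Sum>i\<in>K. if i = j then c i else 0)"
    by (rule sum.cong) (use assms orthonormal in auto)
  also have "\<dots> = (if j \<in> K then c j else 0)" using \<open>finite K\<close> by simp
  finally show ?thesis .
qed

lemma frame_expansion:
  assumes "u \<in> tangent_space A p"
  shows "u = (\<Sum>i=1..m. g p u (X i p) *\<^sub>R X i p)"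
proof -
  obtain c where c: "u = (\<Sum>i=1..m. c i *\<^sub>R X i p)"
    using span_image_sum[OF _ spanning[OF assms]] by blast
  have "g p u (X i p) = c i" if "i \<in> {1..m}" for i
    using g_frame_sum[of "{1..m}" i p c] that unfolding c by simp
  then show ?thesis using c by simp
qed

lemma span_frame_iff:
  assumes "k \<le> m"
  shows "u \<in> span ((\<lambda>i. X i p) ` {1..k}) \<longleftrightarrow> u = (\<Sum>i=1..k. g p u (X i p) *\<^sub>R X i p)"
proof
  assume "u \<in> span ((\<lambda>i. X i p) ` {1..k})"
  then obtain c where c: "u = (\<Sum>i=1..k. c i *\<^sub>R X i p)"
    using span_image_sum by blast
  have "g p u (X i p) = c i" if "i \<in> {1..k}" for i
    using g_frame_sum[of "{1..k}" i p c] that assms unfolding c by simp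
  then show "u = (\<Sum>i=1..k. g p u (X i p) *\<^sub>R X i p)" using c by simp
next
  assume u: "u = (\<Sum>i=1..k. g p u (X i p) *\<^sub>R X i p)"
  show "u \<in> span ((\<lambda>i. X i p) ` {1..k})"
    by (subst u) (intro span_sum span_scale span_base, blast)
qed

text \<open>
  The projection is a definite description, so besides the defining property of the sum its
  uniqueness has to be shown: a horizontal vector is determined by its products with the frame.
\<close>

lemma orthogonal_projection_eq:
  assumes k: "k \<le> m" and u: "u \<in> tangent_space A p"
  shows "orthogonal_projection g (horizontal_bundle k X) p u = (\<Sum>i=1..k. g p u (X i p) *\<^sub>R X i p)"
  unfolding orthogonal_projection_def
proof (rule the_equality)
  let ?P = "\<Sum>i=1..k. g p u (X i p) *\<^sub>R X i p"
  have P: "?P \<in> tangent_space A p"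
    using k frame_tangent by (auto intro!: subspace_sum subspace_scale subspace_tangent_space)
  show "?P \<in> horizontal_bundle k X p \<and> (\<forall>z\<in>horizontal_bundle k X p. g p (u - ?P) z = 0)"
  proof (intro conjI ballI)
    show "?P \<in> horizontal_bundle k X p"
      unfolding horizontal_bundle_def by (intro span_sum span_scale span_base) blast
    fix z assume "z \<in> horizontal_bundle k X p"
    then obtain c where c: "z = (\<Sum>i=1..k. c i *\<^sub>R X i p)"
      unfolding horizontal_bundle_def using span_image_sum by blast
    have z: "z \<in> tangent_space A p" unfolding c
      using k frame_tangent by (auto intro!: subspace_sum subspace_scale subspace_tangent_space)
    have uP: "u - ?P \<in> tangent_space A p" by (rule subspace_diff[OF subspace_tangent_space u P])
    have "g p (u - ?P) z = g p z (u - ?P)" by (rule g_sym[OF uP z])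
    also have "\<dots> = (\<Sum>i=1..k. c i * g p (X i p) (u - ?P))"
      unfolding c by (rule g_sum) (use k frame_tangent uP in auto)
    also have "\<dots> = 0"
    proof (rule sum.neutral, rule ballI)
      fix i assume i: "i \<in> {1..k}"
      then have i': "i \<in> {1..m}" using k by auto
      have "g p (X i p) (u - ?P) = g p (u - ?P) (X i p)" by (rule g_sym[OF frame_tangent[OF i'] uP])
      also have "\<dots> = g p u (X i p) - g p ?P (X i p)" by (rule g_diff[OF u frame_tangent[OF i'] P])
      also have "g p ?P (X i p) = g p u (X i p)"
        using g_frame_sum[of "{1..k}" i p "\<lambda>i. g p u (X i p)"] i i' k by simp
      finally have "g p (X i p) (u - ?P) = 0" by (simp only: diff_self)
      then show "c i * g p (X i p) (u - ?P) = 0" by (simp only: mult_zero_right)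
    qed
    finally show "g p (u - ?P) z = 0" .
  qed
  fix w assume w: "w \<in> horizontal_bundle k X p \<and> (\<forall>z\<in>horizontal_bundle k X p. g p (u - w) z = 0)"
  then have eq: "w = (\<Sum>i=1..k. g p w (X i p) *\<^sub>R X i p)"
    using span_frame_iff[OF k] unfolding horizontal_bundle_def by blast
  have wt: "w \<in> tangent_space A p"
    by (subst eq) (use k frame_tangent in \<open>auto intro!: subspace_sum subspace_scale subspace_tangent_space\<close>)
  have "g p w (X i p) = g p u (X i p)" if i: "i \<in> {1..k}" for i
  proof -
    have "X i p \<in> horizontal_bundle k X p" unfolding horizontal_bundle_def using i by (intro span_base) blast
    then have "g p (u - w) (X i p) = 0" using w by blast
    then show ?thesis using g_diff[OF u frame_tangent wt] i k by simp
  qed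
  then show "w = ?P" using eq by simp
qed

end

section \<open>The Levi-Civita connection in an orthonormal frame\<close>

context orthonormal_frame
begin

lemma nabla_field: "Y \<in> vector_fields A \<Longrightarrow> Z \<in> vector_fields A \<Longrightarrow> nabla Y Z \<in> vector_fields A"
  and nabla_add_left: "Y \<in> vector_fields A \<Longrightarrow> Y' \<in> vector_fields A \<Longrightarrow> Z \<in> vector_fields A
    \<Longrightarrow> nabla (Y + Y') Z = nabla Y Z + nabla Y' Z"
  and nabla_add_right: "Y \<in> vector_fields A \<Longrightarrow> Z \<in> vector_fields A \<Longrightarrow> Z' \<in> vector_fields A
    \<Longrightarrow> nabla Y (Z + Z') = nabla Y Z + nabla Y Z'"
  and nabla_fscale_left: "Y \<in> vector_fields A \<Longrightarrow> Z \<in> vector_fields A \<Longrightarrow> h \<in> smooth_funs A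
    \<Longrightarrow> nabla (fscale h Y) Z = fscale h (nabla Y Z)"
  and nabla_fscale_right: "Y \<in> vector_fields A \<Longrightarrow> Z \<in> vector_fields A \<Longrightarrow> h \<in> smooth_funs A
    \<Longrightarrow> nabla Y (fscale h Z) = fscale (dir_deriv Y h) Z + fscale h (nabla Y Z)"
  using connection unfolding levi_civita_def affine_connection_def by simp_all

lemma nabla_torsion:
    "Y \<in> vector_fields A \<Longrightarrow> Z \<in> vector_fields A \<Longrightarrow> nabla Y Z - nabla Z Y = lie_bracket Y Z"
  and nabla_compatible:
    "Y \<in> vector_fields A \<Longrightarrow> Z \<in> vector_fields A \<Longrightarrow> Z' \<in> vector_fields A \<Longrightarrow>
     dir_deriv Y (\<lambda>p. g p (Z p) (Z' p)) =
       (\<lambda>p. g p (nabla Y Z p) (Z' p) + g p (Z p) (nabla Y Z' p))"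
  using connection unfolding levi_civita_def by simp_all

lemma nabla_sum_left:
  assumes Z: "Z \<in> vector_fields A" and Y: "\<And>i. i \<in> I \<Longrightarrow> Y i \<in> vector_fields A"
  shows "nabla (\<Sum>i\<in>I. Y i) Z = (\<Sum>i\<in>I. nabla (Y i) Z)"
proof -
  have 0: "nabla 0 Z = 0" using nabla_add_left[OF vector_fields_0 vector_fields_0 Z] by simp
  show ?thesis using Y
  proof (induction I rule: infinite_finite_induct)
    case (insert i I)
    have "nabla (Y i + (\<Sum>i\<in>I. Y i)) Z = nabla (Y i) Z + nabla (\<Sum>i\<in>I. Y i) Z"
      by (rule nabla_add_left) (use insert.prems Z in \<open>auto intro: vector_fields_sum\<close>)
    moreover have "nabla (\<Sum>i\<in>I. Y i) Z = (\<Sum>i\<in>I. nabla (Y i) Z)" using insert by blast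
    ultimately show ?case by (simp only: sum.insert[OF insert.hyps])
  qed (simp_all add: 0)
qed

lemma nabla_sum_right:
  assumes Z: "Z \<in> vector_fields A" and Y: "\<And>i. i \<in> I \<Longrightarrow> Y i \<in> vector_fields A"
  shows "nabla Z (\<Sum>i\<in>I. Y i) = (\<Sum>i\<in>I. nabla Z (Y i))"
proof -
  have 0: "nabla Z 0 = 0" using nabla_add_right[OF Z vector_fields_0 vector_fields_0] by simp
  show ?thesis using Y
  proof (induction I rule: infinite_finite_induct)
    case (insert i I)
    have "nabla Z (Y i + (\<Sum>i\<in>I. Y i)) = nabla Z (Y i) + nabla Z (\<Sum>i\<in>I. Y i)"
      by (rule nabla_add_right) (use insert.prems Z in \<open>auto intro: vector_fields_sum\<close>)
    moreover have "nabla Z (\<Sum>i\<in>I. Y i) = (\<Sum>i\<in>I. nabla Z (Y i))" using insert by blast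
    ultimately show ?case by (simp only: sum.insert[OF insert.hyps])
  qed (simp_all add: 0)
qed

lemma vector_field_frame_expansion:
  assumes "Y \<in> vector_fields A"
  shows "Y = (\<Sum>i=1..m. fscale (\<lambda>p. g p (Y p) (X i p)) (X i))"
proof
  fix p
  show "Y p = (\<Sum>i=1..m. fscale (\<lambda>p. g p (Y p) (X i p)) (X i)) p"
    unfolding sum_fscale_apply by (rule frame_expansion[OF vector_fields_tangent[OF assms]])
qed

lemma frame_coordinate_smooth:
  "Y \<in> vector_fields A \<Longrightarrow> i \<in> {1..m} \<Longrightarrow> (\<lambda>p. g p (Y p) (X i p)) \<in> smooth_funs A"
  by (rule g_smooth[OF _ frame_field])

lemma nabla_expand_direction:
  assumes Z: "Z \<in> vector_fields A" and Y: "Y \<in> vector_fields A"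
  shows "nabla Z Y p = (\<Sum>j=1..m. g p (Z p) (X j p) *\<^sub>R nabla (X j) Y p)"
proof -
  let ?z = "\<lambda>j p. g p (Z p) (X j p)"
  have "nabla Z Y = nabla (\<Sum>j=1..m. fscale (?z j) (X j)) Y"
    using vector_field_frame_expansion[OF Z] by (rule arg_cong)
  also have "\<dots> = (\<Sum>j=1..m. nabla (fscale (?z j) (X j)) Y)"
    by (intro nabla_sum_left Y vector_fields_fscale frame_coordinate_smooth Z frame_field)
  also have "\<dots> = (\<Sum>j=1..m. fscale (?z j) (nabla (X j) Y))"
    by (intro sum.cong refl nabla_fscale_left Y frame_coordinate_smooth Z frame_field)
  finally show ?thesis by (simp only: sum_fscale_apply)
qed

lemma nabla_expand_field:
  assumes Z: "Z \<in> vector_fields A" and Y: "Y \<in> vector_fields A"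
  shows "nabla Z Y p = (\<Sum>i=1..m. Z p (\<lambda>q. g q (Y q) (X i q)) *\<^sub>R X i p
    + g p (Y p) (X i p) *\<^sub>R nabla Z (X i) p)"
proof -
  let ?y = "\<lambda>i p. g p (Y p) (X i p)"
  have "nabla Z Y = nabla Z (\<Sum>i=1..m. fscale (?y i) (X i))"
    using vector_field_frame_expansion[OF Y] by (rule arg_cong)
  also have "\<dots> = (\<Sum>i=1..m. nabla Z (fscale (?y i) (X i)))"
    by (intro nabla_sum_right Y vector_fields_fscale frame_coordinate_smooth Z frame_field)
  also have "\<dots> = (\<Sum>i=1..m. fscale (dir_deriv Z (?y i)) (X i) + fscale (?y i) (nabla Z (X i)))"
    by (intro sum.cong refl nabla_fscale_right Y frame_coordinate_smooth Z frame_field)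
  finally show ?thesis by (simp only: sum_fscale_add_apply dir_deriv_def)
qed

lemma nabla_frame_metric:
  assumes "i \<in> {1..m}" "j \<in> {1..m}" "l \<in> {1..m}"
  shows "g p (nabla (X i) (X j) p) (X l p) = - g p (nabla (X i) (X l) p) (X j p)"
proof -
  note f = frame_field[OF assms(1)] frame_field[OF assms(2)] frame_field[OF assms(3)]
  have "(\<lambda>q. g q (X j q) (X l q)) = (\<lambda>_. if j = l then 1 else 0)"
    by (intro ext orthonormal assms)
  then have "0 = dir_deriv (X i) (\<lambda>q. g q (X j q) (X l q)) p"
    using tangent_space_const[OF frame_tangent[OF assms(1)]] by (simp only: dir_deriv_def)
  also have "\<dots> = g p (nabla (X i) (X j) p) (X l p) + g p (X j p) (nabla (X i) (X l) p)"
    using nabla_compatible[OF f] by (rule fun_cong)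
  also have "g p (X j p) (nabla (X i) (X l) p) = g p (nabla (X i) (X l) p) (X j p)"
    by (intro g_sym vector_fields_tangent nabla_field f)
  finally show ?thesis by linarith
qed

lemma nabla_frame_torsion:
  assumes "i \<in> {1..m}" "j \<in> {1..m}" "l \<in> {1..m}"
  shows "g p (nabla (X i) (X j) p) (X l p) - g p (nabla (X j) (X i) p) (X l p)
    = g p (lie_bracket (X i) (X j) p) (X l p)"
proof -
  note f = frame_field[OF assms(1)] frame_field[OF assms(2)] frame_field[OF assms(3)]
  have "lie_bracket (X i) (X j) p = nabla (X i) (X j) p - nabla (X j) (X i) p"
    using nabla_torsion[OF f(1,2)] by (metis minus_apply)
  moreover have "g p (nabla (X i) (X j) p - nabla (X j) (X i) p) (X l p)
      = g p (nabla (X i) (X j) p) (X l p) - g p (nabla (X j) (X i) p) (X l p)"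
    by (intro g_diff vector_fields_tangent nabla_field f)
  ultimately show ?thesis by simp
qed

text \<open>
  The numbers \<open>g (\<nabla>\<^sub>i X\<^sub>j) X\<^sub>l\<close> are skew in \<open>j\<close> and \<open>l\<close> because the products of frame fields are
  constant, and symmetric in \<open>i\<close> and \<open>j\<close> because the torsion term \<open>g [X\<^sub>i, X\<^sub>j] X\<^sub>l\<close> vanishes. A
  quantity with both symmetries is zero: six transpositions return to the original indices with
  three changes of sign.
\<close>

lemma nabla_frame_orthogonal:
  assumes k: "k \<le> m"
    and bracket: "\<And>i j l. i \<in> {1..k} \<Longrightarrow> j \<in> {1..k} \<Longrightarrow> l \<in> {1..k} \<Longrightarrow>
      g p (lie_bracket (X i) (X j) p) (X l p) = 0"
    and ijl: "i \<in> {1..k}" "j \<in> {1..k}" "l \<in> {1..k}"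
  shows "g p (nabla (X i) (X j) p) (X l p) = 0"
proof -
  let ?G = "\<lambda>i j l. g p (nabla (X i) (X j) p) (X l p)"
  have "{1..k} \<subseteq> {1..m}" using k by auto
  then have skew: "?G a b c = - ?G a c b" and sym: "?G a b c = ?G b a c"
    if "a \<in> {1..k}" "b \<in> {1..k}" "c \<in> {1..k}" for a b c
    using that nabla_frame_metric[of a b c p] nabla_frame_torsion[of a b c p] bracket[of a b c]
    by auto
  have "?G i j l = - ?G i l j" "?G i l j = ?G l i j" "?G l i j = - ?G l j i"
    "?G l j i = ?G j l i" "?G j l i = - ?G j i l" "?G j i l = ?G i j l"
    using skew sym ijl by blast+
  then show ?thesis by linarith
qed

end

section \<open>The covariant derivative along a curve\<close>

lemma smooth_curve_differentiable:
  assumes A: "smooth_atlas A" and \<gamma>: "smooth_curve A J \<gamma>"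
  shows "differentiable_curve A J \<gamma>"
  unfolding differentiable_curve_def
proof (intro conjI, goal_cases)
  case 1 then show ?case using \<gamma> unfolding smooth_curve_def by blast
next
  case 2
  show ?case
  proof clarify
    fix U \<phi> t assume U: "(U, \<phi>) \<in> A" and t: "t \<in> J" "\<gamma> t \<in> U"
    have c: "continuous_on J \<gamma>" using \<gamma> unfolding smooth_curve_def by blast
    obtain N where N: "open N" "{t\<in>J. \<gamma> t \<in> U} = J \<inter> N" "\<And>t. t \<in> J \<Longrightarrow> t \<in> N \<longleftrightarrow> \<gamma> t \<in> U"
      using curve_preimage_open[OF c smooth_atlas_chart(1)[OF A U]] by blast
    have "smooth_on {t\<in>J. \<gamma> t \<in> U} (\<phi> \<circ> \<gamma>)" using \<gamma> U unfolding smooth_curve_def by blast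
    then have "Ck_on (Suc 0) (J \<inter> N) (\<phi> \<circ> \<gamma>)" unfolding smooth_on_def N(2) by blast
    then have "(\<phi> \<circ> \<gamma>) differentiable (at t within J \<inter> N)"
      using t N(3) by (auto simp: differentiable_def)
    moreover have "at t within J \<inter> N = at t within J"
      by (rule at_within_nhd[of t N]) (use t N in auto)
    ultimately show "(\<phi> \<circ> \<gamma>) differentiable (at t within J)" by simp
  qed
qed

locale framed_curve = orthonormal_frame A g nabla m X
  for A :: "('a::{t2_space, second_countable_topology}, 'e::euclidean_space) chart set"
    and g nabla m X +
  fixes J :: "real set" and \<gamma> :: "real \<Rightarrow> 'a"
  assumes interval: "approachable J"
    and smooth: "smooth_curve A J \<gamma>"
begin

abbreviation "vel \<equiv> velocity A J \<gamma>"

lemma vel_deriv: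
  "f \<in> smooth_funs A \<Longrightarrow> t \<in> J \<Longrightarrow>
    ((\<lambda>t. f (\<gamma> t)) has_vector_derivative vel t f) (at t within J)"
  by (rule differentiable_curve_comp[OF atlas smooth_curve_differentiable[OF atlas smooth]])

lemma vel_eqI:
  "f \<in> smooth_funs A \<Longrightarrow> t \<in> J \<Longrightarrow>
    ((\<lambda>t. f (\<gamma> t)) has_vector_derivative y) (at t within J) \<Longrightarrow> vel t f = y"
  using vector_derivative_eqI[OF interval] vel_deriv by metis

lemma vel_tangent:
  assumes t: "t \<in> J"
  shows "vel t \<in> tangent_space A (\<gamma> t)"
  unfolding tangent_space_def
proof (intro CollectI conjI allI ballI impI)
  fix f assume "f \<notin> smooth_funs A" then show "vel t f = 0" by (simp add: velocity_def)
next
  fix f c assume f: "f \<in> smooth_funs A"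
  have s: "c *\<^sub>R f \<in> smooth_funs A"
    using smooth_funs_mult[OF smooth_funs_const f, of c] by (simp add: scaleR_fun_def)
  show "vel t (c *\<^sub>R f) = c * vel t f"
    by (rule vel_eqI[OF s t])
       (use has_vector_derivative_mult_right[OF vel_deriv[OF f t], of c] in simp)
next
  fix f h assume f: "f \<in> smooth_funs A" and h: "h \<in> smooth_funs A"
  have "f + h \<in> smooth_funs A" "f * h \<in> smooth_funs A"
    using smooth_funs_add[OF f h] smooth_funs_mult[OF f h]
    by (simp_all add: plus_fun_def times_fun_def)
  then show "vel t (f + h) = vel t f + vel t h"
    "vel t (f * h) = f (\<gamma> t) * vel t h + h (\<gamma> t) * vel t f"
    using has_vector_derivative_add[OF vel_deriv[OF f t] vel_deriv[OF h t]]
      has_vector_derivative_mult[OF vel_deriv[OF f t] vel_deriv[OF h t]]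
    by (auto intro!: vel_eqI t simp: mult.commute)
qed

lemma comp_smooth: "f \<in> smooth_funs A \<Longrightarrow> smooth_on J (\<lambda>t. f (\<gamma> t))"
  by (rule smooth_curve_comp[OF atlas interval smooth])

abbreviation "along \<equiv> fields_along A J \<gamma>"

lemma along_tangent: "W \<in> along \<Longrightarrow> t \<in> J \<Longrightarrow> W t \<in> tangent_space A (\<gamma> t)"
  and along_smooth: "W \<in> along \<Longrightarrow> f \<in> smooth_funs A \<Longrightarrow> smooth_on J (\<lambda>t. W t f)"
  unfolding fields_along_def by blast+

lemma along_add: "V \<in> along \<Longrightarrow> W \<in> along \<Longrightarrow> V + W \<in> along"
  unfolding fields_along_def
  by (auto intro: smooth_on_add subspace_add[OF subspace_tangent_space])

lemma along_fscale: "smooth_on J h \<Longrightarrow> W \<in> along \<Longrightarrow> fscale h W \<in> along"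
  unfolding fields_along_def fscale_def
  by (auto intro: smooth_on_mult subspace_scale[OF subspace_tangent_space])

lemma along_0: "0 \<in> along"
  unfolding fields_along_def
  by (auto intro: smooth_on_const subspace_0[OF subspace_tangent_space])

lemma along_sum: "(\<And>i. i \<in> I \<Longrightarrow> W i \<in> along) \<Longrightarrow> (\<Sum>i\<in>I. W i) \<in> along"
  by (induction I rule: infinite_finite_induct) (auto intro: along_0 along_add)

lemma along_restrict: "Y \<in> vector_fields A \<Longrightarrow> Y \<circ> \<gamma> \<in> along"
  unfolding fields_along_def
  using comp_smooth[OF vector_fields_smooth] vector_fields_tangent
  by (auto simp: dir_deriv_def)

lemma along_vel: "vel \<in> along"
  unfolding fields_along_def
proof (intro CollectI conjI ballI vel_tangent)
  fix f assume f: "f \<in> smooth_funs A"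
  then show "smooth_on J (\<lambda>t. vel t f)"
    using smooth_on_vector_derivative[OF interval comp_smooth[OF f]] by (simp add: velocity_def o_def)
qed

definition coef :: "(real \<Rightarrow> 'a tvec) \<Rightarrow> nat \<Rightarrow> real \<Rightarrow> real" where
  "coef W i t = g (\<gamma> t) (W t) (X i (\<gamma> t))"

lemma along_expansion:
  "W \<in> along \<Longrightarrow> t \<in> J \<Longrightarrow> W t = (\<Sum>i=1..m. coef W i t *\<^sub>R X i (\<gamma> t))"
  unfolding coef_def by (rule frame_expansion[OF along_tangent])

text \<open>
  Smoothness of a field along the curve is known only through its values on smooth functions of the
  manifold. These values are a linear system for the coefficients, with the derivatives of the test
  functions along the frame as matrix, and orthonormality makes the system nondegenerate.
\<close>

lemma coef_smooth:
  assumes W: "W \<in> along" and i: "i \<in> {1..m}"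
  shows "smooth_on J (coef W i)"
proof (rule smooth_on_local[OF interval])
  fix t assume t: "t \<in> J"
  show "smooth_near J t (coef W i)"
  proof (rule smooth_near_coefficients[OF t, where F = "smooth_funs A" and n = m and W = W
        and E = "\<lambda>i s. X i (\<gamma> s)" and N = UNIV])
    show "smooth_near J t (\<lambda>s. X i (\<gamma> s) f)" if "i \<in> {1..m}" "f \<in> smooth_funs A" for i f
      using smooth_on_imp_near[OF comp_smooth[OF vector_fields_smooth[OF frame_field[OF that(1)] that(2)]]]
      by (simp add: dir_deriv_def)
    show "smooth_near J t (\<lambda>s. W s f)" if "f \<in> smooth_funs A" for f
      by (rule smooth_on_imp_near[OF along_smooth[OF W that]])
    show "W s f = (\<Sum>i=1..m. coef W i s * X i (\<gamma> s) f)" if "s \<in> J \<inter> UNIV" for s f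
    proof -
      have "W s f = (\<Sum>i=1..m. coef W i s *\<^sub>R X i (\<gamma> s)) f"
        using along_expansion[OF W] that by (metis IntD1)
      then show ?thesis by (simp add: sum_fun_apply)
    qed
    fix c j
    assume c: "\<And>f. f \<in> smooth_funs A \<Longrightarrow> (\<Sum>i=1..m. c i * X i (\<gamma> t) f) = 0" and j: "j \<in> {1..m}"
    have "(\<Sum>i=1..m. c i *\<^sub>R X i (\<gamma> t)) = 0"
    proof
      fix f
      show "(\<Sum>i=1..m. c i *\<^sub>R X i (\<gamma> t)) f = 0 f"
      proof (cases "f \<in> smooth_funs A")
        case True
        then show ?thesis using c by (simp add: sum_fun_apply)
      next
        case False
        then have "X i (\<gamma> t) f = 0" if "i \<in> {1..m}" for i
          using frame_tangent[OF that, of "\<gamma> t"] unfolding tangent_space_def by blast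
        then show ?thesis by (simp add: sum_fun_apply)
      qed
    qed
    then have "c j = g (\<gamma> t) 0 (X j (\<gamma> t))"
      using g_frame_sum[OF order_refl j, of "\<gamma> t" c] j by simp
    also have "\<dots> = 0" by (rule g_zero[OF frame_tangent[OF j]])
    finally show "c j = 0" .
  qed (use i in auto)
qed

lemma coef_deriv:
  "W \<in> along \<Longrightarrow> i \<in> {1..m} \<Longrightarrow> t \<in> J \<Longrightarrow>
    (coef W i has_vector_derivative vector_derivative (coef W i) (at t within J)) (at t within J)"
  by (rule smooth_on_has_vector_derivative[OF coef_smooth])

lemma coef_deriv_eqI:
  assumes t: "t \<in> J" and "(h has_vector_derivative y) (at t within J)" "\<And>s. s \<in> J \<Longrightarrow> coef W i s = h s"
  shows "vector_derivative (coef W i) (at t within J) = y"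
  by (rule vector_derivative_eqI[OF interval t])
     (rule has_vector_derivative_transform[OF t assms(3) assms(2)])

text \<open>
  This is the derivative of the \<open>i\<close>-th frame field in the direction of the velocity, see
  \<open>frame_conn_eq\<close>; it is written out so that it makes sense without extending the velocity to a
  vector field on the manifold.
\<close>

definition frame_conn :: "nat \<Rightarrow> real \<Rightarrow> 'a tvec" where
  "frame_conn i t = (\<Sum>j=1..m. coef vel j t *\<^sub>R nabla (X j) (X i) (\<gamma> t))"

text \<open>
  The formula that the product rule forces on the covariant derivative of a field with coefficients
  \<open>coef W i\<close>.
\<close>

definition frame_cov :: "(real \<Rightarrow> 'a tvec) \<Rightarrow> real \<Rightarrow> 'a tvec" where
  "frame_cov W t = (\<Sum>i=1..m. vector_derivative (coef W i) (at t within J) *\<^sub>R X i (\<gamma> t)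
    + coef W i t *\<^sub>R frame_conn i t)"

lemma frame_conn_eq:
  assumes "Z \<in> vector_fields A" "Z (\<gamma> t) = vel t" "i \<in> {1..m}"
  shows "nabla Z (X i) (\<gamma> t) = frame_conn i t"
  unfolding frame_conn_def coef_def assms(2)[symmetric]
  by (rule nabla_expand_direction[OF assms(1) frame_field[OF assms(3)]])

lemma frame_cov_along:
  assumes W: "W \<in> along"
  shows "frame_cov W \<in> along"
proof -
  have "frame_cov W = (\<Sum>i=1..m.
      fscale (\<lambda>t. vector_derivative (coef W i) (at t within J)) (X i \<circ> \<gamma>) +
      fscale (coef W i) (\<Sum>j=1..m. fscale (coef vel j) (nabla (X j) (X i) \<circ> \<gamma>)))"
    by (rule ext)
      (simp only: frame_cov_def frame_conn_def sum_fscale_add_apply sum_fscale_apply o_apply)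
  moreover have "\<dots> \<in> along"
    by (intro along_sum along_add along_fscale along_restrict smooth_on_vector_derivative interval
        coef_smooth W along_vel nabla_field frame_field)
  ultimately show ?thesis by (simp only:)
qed

lemma frame_cov_cong:
  assumes W: "W \<in> along" and t: "t \<in> J" and eq: "\<And>s. s \<in> J \<Longrightarrow> V s = W s"
  shows "frame_cov V t = frame_cov W t"
  unfolding frame_cov_def
proof (rule sum.cong[OF refl])
  fix i assume i: "i \<in> {1..m}"
  have c: "coef V i s = coef W i s" if "s \<in> J" for s using eq[OF that] by (simp only: coef_def)
  have "vector_derivative (coef V i) (at t within J) = vector_derivative (coef W i) (at t within J)"
    by (rule coef_deriv_eqI[OF t coef_deriv[OF W i t] c])
  then show "vector_derivative (coef V i) (at t within J) *\<^sub>R X i (\<gamma> t) + coef V i t *\<^sub>R frame_conn i t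
      = vector_derivative (coef W i) (at t within J) *\<^sub>R X i (\<gamma> t) + coef W i t *\<^sub>R frame_conn i t"
    by (simp only: c[OF t])
qed

lemma frame_cov_add:
  assumes V: "V \<in> along" and W: "W \<in> along" and t: "t \<in> J"
  shows "frame_cov (V + W) t = frame_cov V t + frame_cov W t"
  unfolding frame_cov_def sum.distrib[symmetric]
proof (rule sum.cong[OF refl])
  fix i assume i: "i \<in> {1..m}"
  have c: "coef (V + W) i s = coef V i s + coef W i s" if "s \<in> J" for s
    unfolding coef_def
    by (subst plus_fun_apply) (intro g_add along_tangent V W that frame_tangent i)
  have "vector_derivative (coef (V + W) i) (at t within J)
      = vector_derivative (coef V i) (at t within J) + vector_derivative (coef W i) (at t within J)"
    by (rule coef_deriv_eqI[OF t has_vector_derivative_add[OF coef_deriv[OF V i t] coef_deriv[OF W i t]] c])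
  then show "vector_derivative (coef (V + W) i) (at t within J) *\<^sub>R X i (\<gamma> t) + coef (V + W) i t *\<^sub>R frame_conn i t
      = (vector_derivative (coef V i) (at t within J) *\<^sub>R X i (\<gamma> t) + coef V i t *\<^sub>R frame_conn i t) +
        (vector_derivative (coef W i) (at t within J) *\<^sub>R X i (\<gamma> t) + coef W i t *\<^sub>R frame_conn i t)"
    unfolding c[OF t] by (simp only: scaleR_add_left add_ac)
qed

lemma frame_cov_fscale:
  assumes h: "smooth_on J h" and W: "W \<in> along" and t: "t \<in> J"
  shows "frame_cov (fscale h W) t
    = vector_derivative h (at t within J) *\<^sub>R W t + h t *\<^sub>R frame_cov W t"
proof -
  let ?h' = "vector_derivative h (at t within J)"
  have "frame_cov (fscale h W) t = (\<Sum>i=1..m. ?h' *\<^sub>R (coef W i t *\<^sub>R X i (\<gamma> t)) +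
      h t *\<^sub>R (vector_derivative (coef W i) (at t within J) *\<^sub>R X i (\<gamma> t) + coef W i t *\<^sub>R frame_conn i t))"
    unfolding frame_cov_def
  proof (rule sum.cong[OF refl])
    fix i assume i: "i \<in> {1..m}"
    let ?c' = "vector_derivative (coef W i) (at t within J)"
    have c: "coef (fscale h W) i s = h s * coef W i s" if "s \<in> J" for s
      unfolding coef_def fscale_def
      by (intro g_scale along_tangent W that frame_tangent i)
    have "vector_derivative (coef (fscale h W) i) (at t within J) = h t * ?c' + ?h' * coef W i t"
      by (rule coef_deriv_eqI[OF t has_vector_derivative_mult[OF
              smooth_on_has_vector_derivative[OF h t] coef_deriv[OF W i t]] c])
    then show "vector_derivative (coef (fscale h W) i) (at t within J) *\<^sub>R X i (\<gamma> t)
          + coef (fscale h W) i t *\<^sub>R frame_conn i t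
        = ?h' *\<^sub>R (coef W i t *\<^sub>R X i (\<gamma> t)) +
          h t *\<^sub>R (?c' *\<^sub>R X i (\<gamma> t) + coef W i t *\<^sub>R frame_conn i t)"
      unfolding c[OF t] by (simp only: scaleR_add_left scaleR_add_right scaleR_scaleR add_ac)
  qed
  also have "\<dots> = ?h' *\<^sub>R (\<Sum>i=1..m. coef W i t *\<^sub>R X i (\<gamma> t)) + h t *\<^sub>R frame_cov W t"
    unfolding frame_cov_def scaleR_sum_right by (rule sum.distrib)
  also have "(\<Sum>i=1..m. coef W i t *\<^sub>R X i (\<gamma> t)) = W t"
    by (rule along_expansion[OF W t, symmetric])
  finally show ?thesis .
qed

lemma frame_cov_restrict:
  assumes Z: "Z \<in> vector_fields A" and Y: "Y \<in> vector_fields A" and t: "t \<in> J"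
    and v: "Z (\<gamma> t) = vel t"
  shows "frame_cov (Y \<circ> \<gamma>) t = nabla Z Y (\<gamma> t)"
  unfolding frame_cov_def nabla_expand_field[OF Z Y, of "\<gamma> t"]
proof (rule sum.cong[OF refl])
  fix i assume i: "i \<in> {1..m}"
  have c: "coef (Y \<circ> \<gamma>) i s = g (\<gamma> s) (Y (\<gamma> s)) (X i (\<gamma> s))" for s
    by (simp only: coef_def o_apply)
  have "vector_derivative (coef (Y \<circ> \<gamma>) i) (at t within J) = vel t (\<lambda>q. g q (Y q) (X i q))"
    by (rule coef_deriv_eqI[OF t vel_deriv[OF frame_coordinate_smooth[OF Y i] t] c])
  then show "vector_derivative (coef (Y \<circ> \<gamma>) i) (at t within J) *\<^sub>R X i (\<gamma> t)
        + coef (Y \<circ> \<gamma>) i t *\<^sub>R frame_conn i t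
      = Z (\<gamma> t) (\<lambda>q. g q (Y q) (X i q)) *\<^sub>R X i (\<gamma> t)
        + g (\<gamma> t) (Y (\<gamma> t)) (X i (\<gamma> t)) *\<^sub>R nabla Z (X i) (\<gamma> t)"
    by (simp only: c v frame_conn_eq[OF Z v i])
qed

lemma frame_cov_is_covariant_derivative: "is_covariant_derivative_along A nabla J \<gamma> frame_cov"
  unfolding is_covariant_derivative_along_def
proof (intro conjI ballI allI impI)
  fix W :: "real \<Rightarrow> 'a tvec" and c t assume W: "W \<in> along" and t: "t \<in> J"
  have "frame_cov (fscale (\<lambda>_. c) W) t = c *\<^sub>R frame_cov W t"
    using frame_cov_fscale[OF smooth_on_const W t, of c]
      vector_derivative_eqI[OF interval t has_vector_derivative_const, of c] by simp
  moreover have "fscale (\<lambda>_. c) W = c *\<^sub>R W" by (simp add: fun_eq_iff fscale_def)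
  ultimately show "frame_cov (c *\<^sub>R W) t = c *\<^sub>R frame_cov W t" by (simp only:)
next
  fix V W t
  assume "V \<in> along" "W \<in> along" "\<forall>t\<in>J. V t = W t" "t \<in> J"
  then show "frame_cov V t = frame_cov W t" using frame_cov_cong by blast
qed (auto intro: frame_cov_along frame_cov_add frame_cov_fscale frame_cov_restrict)

text \<open>
  The axioms determine the operator: expand the field in the frame, and at the single time \<open>t\<close>
  extend the velocity by the field with constant coefficients \<open>coef vel j t\<close>.
\<close>

lemma covariant_derivative_unique:
  assumes D: "is_covariant_derivative_along A nabla J \<gamma> D" and W: "W \<in> along" and t: "t \<in> J"
  shows "D W t = frame_cov W t"
proof -
  note D' = D[unfolded is_covariant_derivative_along_def]
  have D_cong: "D V t = D W t" if "V \<in> along" "W \<in> along" "\<And>t. t \<in> J \<Longrightarrow> V t = W t" for V W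
    using D'[THEN conjunct1, rule_format, OF that(1,2) _ t] that(3) by blast
  have D_add: "D (V + W) t = D V t + D W t" if "V \<in> along" "W \<in> along" for V W
    by (rule D'[THEN conjunct2, THEN conjunct2, THEN conjunct1, rule_format, OF that t])
  have D_scale: "D (c *\<^sub>R V) t = c *\<^sub>R D V t" if "V \<in> along" for V c
    by (rule D'[THEN conjunct2, THEN conjunct2, THEN conjunct2, THEN conjunct1, rule_format, OF that t])
  have D_fscale: "D (fscale h V) t = vector_derivative h (at t within J) *\<^sub>R V t + h t *\<^sub>R D V t"
    if "V \<in> along" "smooth_on J h" for V h
    by (rule D'[THEN conjunct2, THEN conjunct2, THEN conjunct2, THEN conjunct2, THEN conjunct1,
          rule_format, OF that t])
  have D_restrict: "D (Y \<circ> \<gamma>) t = nabla Z Y (\<gamma> t)"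
    if "Z \<in> vector_fields A" "Y \<in> vector_fields A" "Z (\<gamma> t) = vel t" for Y Z
    by (rule D'[THEN conjunct2, THEN conjunct2, THEN conjunct2, THEN conjunct2, THEN conjunct2,
          rule_format, OF that(1,2) t that(3)])
  have D_0: "D 0 t = 0" using D_scale[OF along_0, of 0] by simp
  have D_sum: "D (\<Sum>i\<in>I. V i) t = (\<Sum>i\<in>I. D (V i) t)" if "\<And>i. i \<in> I \<Longrightarrow> V i \<in> along"
    for V :: "nat \<Rightarrow> real \<Rightarrow> 'a tvec" and I
    using that
  proof (induction I rule: infinite_finite_induct)
    case (insert i I)
    have "D (V i + (\<Sum>i\<in>I. V i)) t = D (V i) t + D (\<Sum>i\<in>I. V i) t"
      by (rule D_add) (use insert.prems in \<open>auto intro: along_sum\<close>)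
    moreover have "D (\<Sum>i\<in>I. V i) t = (\<Sum>i\<in>I. D (V i) t)" using insert by blast
    ultimately show ?case by (simp only: sum.insert[OF insert.hyps])
  qed (simp_all add: D_0)
  define Z where "Z = (\<lambda>p. \<Sum>j=1..m. coef vel j t *\<^sub>R X j p)"
  have Z: "Z \<in> vector_fields A"
    unfolding Z_def by (intro vector_fields_linear_combination frame_field)
  have Zt: "Z (\<gamma> t) = vel t" unfolding Z_def by (rule along_expansion[OF along_vel t, symmetric])
  have field: "fscale (coef W i) (X i \<circ> \<gamma>) \<in> along" if "i \<in> {1..m}" for i
    by (intro along_fscale coef_smooth W that along_restrict frame_field)
  have "D W t = D (\<Sum>i=1..m. fscale (coef W i) (X i \<circ> \<gamma>)) t"
  proof (rule D_cong[OF W along_sum[OF field]])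
    show "W s = (\<Sum>i=1..m. fscale (coef W i) (X i \<circ> \<gamma>)) s" if "s \<in> J" for s
      using along_expansion[OF W that] by (simp only: sum_fscale_apply o_apply)
  qed
  also have "\<dots> = (\<Sum>i=1..m. D (fscale (coef W i) (X i \<circ> \<gamma>)) t)" by (rule D_sum[OF field])
  also have "\<dots> = frame_cov W t"
    unfolding frame_cov_def
  proof (rule sum.cong[OF refl])
    fix i assume i: "i \<in> {1..m}"
    have "D (X i \<circ> \<gamma>) t = frame_conn i t"
      using D_restrict[OF Z frame_field[OF i] Zt] frame_conn_eq[OF Z Zt i] by (rule trans)
    then show "D (fscale (coef W i) (X i \<circ> \<gamma>)) t
        = vector_derivative (coef W i) (at t within J) *\<^sub>R X i (\<gamma> t) + coef W i t *\<^sub>R frame_conn i t"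
      using D_fscale[OF along_restrict[OF frame_field[OF i]] coef_smooth[OF W i]]
      by (simp only: o_apply)
  qed
  finally show ?thesis .
qed

lemma covariant_derivative_along_eq:
  "W \<in> along \<Longrightarrow> t \<in> J \<Longrightarrow> covariant_derivative_along A nabla J \<gamma> W t = frame_cov W t"
  unfolding covariant_derivative_along_def
  by (rule covariant_derivative_unique[OF someI[of "is_covariant_derivative_along A nabla J \<gamma>",
        OF frame_cov_is_covariant_derivative]])

text \<open>
  The coefficients of the velocity vanish outside the horizontal frame fields, so the connection
  terms in the horizontal components of the acceleration involve only products
  \<open>g (\<nabla>\<^sub>j X\<^sub>i) X\<^sub>l\<close> with three horizontal indices, and these are zero by \<open>nabla_frame_orthogonal\<close>. What
  remains is the derivative of the coefficients.
\<close>

lemma projected_acceleration: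
  assumes k: "k \<le> m"
    and bracket: "\<And>p i j l. i \<in> {1..k} \<Longrightarrow> j \<in> {1..k} \<Longrightarrow> l \<in> {1..k} \<Longrightarrow>
      g p (lie_bracket (X i) (X j) p) (X l p) = 0"
    and horizontal: "\<And>t. t \<in> J \<Longrightarrow> vel t \<in> horizontal_bundle k X (\<gamma> t)"
    and t: "t \<in> J"
  shows "orthogonal_projection g (horizontal_bundle k X) (\<gamma> t)
      (covariant_derivative_along A nabla J \<gamma> vel t)
    = (\<Sum>l=1..k. vector_derivative (coef vel l) (at t within J) *\<^sub>R X l (\<gamma> t))"
proof -
  let ?d = "\<lambda>i. vector_derivative (coef vel i) (at t within J)"
  have vertical: "coef vel i t = 0" if "i \<in> {1..m}" "i \<notin> {1..k}" for i
  proof -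
    have "vel t = (\<Sum>i=1..k. g (\<gamma> t) (vel t) (X i (\<gamma> t)) *\<^sub>R X i (\<gamma> t))"
      using horizontal[OF t] span_frame_iff[OF k] unfolding horizontal_bundle_def by blast
    then have "coef vel i t = g (\<gamma> t) (\<Sum>i=1..k. g (\<gamma> t) (vel t) (X i (\<gamma> t)) *\<^sub>R X i (\<gamma> t)) (X i (\<gamma> t))"
      unfolding coef_def by (rule arg_cong)
    also have "\<dots> = 0"
      using g_frame_sum[of "{1..k}" i "\<gamma> t" "\<lambda>i. g (\<gamma> t) (vel t) (X i (\<gamma> t))"] that k by auto
    finally show ?thesis .
  qed
  have tangent: "nabla (X j) (X i) (\<gamma> t) \<in> tangent_space A (\<gamma> t)"
    if "i \<in> {1..m}" "j \<in> {1..m}" for i j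
    by (intro vector_fields_tangent nabla_field frame_field that)
  have conn_tangent: "frame_conn i t \<in> tangent_space A (\<gamma> t)" if "i \<in> {1..m}" for i
    unfolding frame_conn_def
    by (intro subspace_sum subspace_scale subspace_tangent_space tangent that)
  have "g (\<gamma> t) (frame_cov vel t) (X l (\<gamma> t)) = ?d l" if l: "l \<in> {1..k}" for l
  proof -
    have lm: "l \<in> {1..m}" using l k by auto
    have conn: "coef vel i t * g (\<gamma> t) (frame_conn i t) (X l (\<gamma> t)) = 0" if i: "i \<in> {1..m}" for i
    proof (cases "i \<in> {1..k}")
      case True
      have "g (\<gamma> t) (frame_conn i t) (X l (\<gamma> t))
          = (\<Sum>j=1..m. coef vel j t * g (\<gamma> t) (nabla (X j) (X i) (\<gamma> t)) (X l (\<gamma> t)))"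
        unfolding frame_conn_def by (intro g_sum tangent i frame_tangent lm)
      also have "\<dots> = 0"
        using vertical nabla_frame_orthogonal[where p = "\<gamma> t", OF k bracket _ True l]
        by (intro sum.neutral ballI) (metis mult_eq_0_iff)
      finally show ?thesis by simp
    next
      case False
      then show ?thesis using vertical i by simp
    qed
    have "frame_cov vel t = (\<Sum>i=1..m. ?d i *\<^sub>R X i (\<gamma> t)) + (\<Sum>i=1..m. coef vel i t *\<^sub>R frame_conn i t)"
      unfolding frame_cov_def by (rule sum.distrib)
    then have "g (\<gamma> t) (frame_cov vel t) (X l (\<gamma> t))
        = g (\<gamma> t) ((\<Sum>i=1..m. ?d i *\<^sub>R X i (\<gamma> t)) + (\<Sum>i=1..m. coef vel i t *\<^sub>R frame_conn i t)) (X l (\<gamma> t))"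
      by (simp only:)
    also have "\<dots> = g (\<gamma> t) (\<Sum>i=1..m. ?d i *\<^sub>R X i (\<gamma> t)) (X l (\<gamma> t))
        + g (\<gamma> t) (\<Sum>i=1..m. coef vel i t *\<^sub>R frame_conn i t) (X l (\<gamma> t))"
      by (intro g_add subspace_sum subspace_scale subspace_tangent_space frame_tangent conn_tangent lm)
    also have "g (\<gamma> t) (\<Sum>i=1..m. ?d i *\<^sub>R X i (\<gamma> t)) (X l (\<gamma> t)) = ?d l"
      using g_frame_sum[OF order_refl lm, of "\<gamma> t" ?d] lm by simp
    also have "g (\<gamma> t) (\<Sum>i=1..m. coef vel i t *\<^sub>R frame_conn i t) (X l (\<gamma> t))
        = (\<Sum>i=1..m. coef vel i t * g (\<gamma> t) (frame_conn i t) (X l (\<gamma> t)))"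
      by (intro g_sum conn_tangent frame_tangent lm)
    also have "\<dots> = 0" by (intro sum.neutral ballI conn)
    finally show ?thesis by simp
  qed
  then have "(\<Sum>l=1..k. g (\<gamma> t) (frame_cov vel t) (X l (\<gamma> t)) *\<^sub>R X l (\<gamma> t))
      = (\<Sum>l=1..k. ?d l *\<^sub>R X l (\<gamma> t))"
    by (intro sum.cong refl) (simp only:)
  then show ?thesis
    unfolding covariant_derivative_along_eq[OF along_vel t]
      orthogonal_projection_eq[OF k along_tangent[OF frame_cov_along[OF along_vel] t]] .
qed

end

section \<open>Geodesics of a frame with brackets orthogonal to the distribution\<close>

text \<open>
  By \<open>projected_acceleration\<close> a smooth horizontal curve is a geodesic exactly when the coefficients
  of its velocity have derivative zero, that is, are constant on the interval. In the
  converse direction the curve is only known to be differentiable, and its smoothness comes from \<open>integral_curve_smooth\<close>.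
\<close>

theorem (in orthonormal_frame) nonholonomic_geodesic_iff_constant_coefficients:
  assumes k: "k \<le> m"
    and bracket: "\<And>p i j l. i \<in> {1..k} \<Longrightarrow> j \<in> {1..k} \<Longrightarrow> l \<in> {1..k} \<Longrightarrow>
      g p (lie_bracket (X i) (X j) p) (X l p) = 0"
    and J: "is_interval J" "interior J \<noteq> {}"
    and horizontal: "horizontal_curve A (horizontal_bundle k X) J \<gamma>"
  shows "nonholonomic_geodesic A g nabla (horizontal_bundle k X) J \<gamma> \<longleftrightarrow>
    (\<exists>Y\<in>left_invariant_horizontal_fields k X. integral_curve A Y J \<gamma>)"
proof
  note app = approachable_interval[OF J]
  have d: "differentiable_curve A J \<gamma>"
    and hor: "\<And>t. t \<in> J \<Longrightarrow> velocity A J \<gamma> t \<in> horizontal_bundle k X (\<gamma> t)"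
    using horizontal unfolding horizontal_curve_def by auto
  {
    assume geo: "nonholonomic_geodesic A g nabla (horizontal_bundle k X) J \<gamma>"
    then have "smooth_curve A J \<gamma>" unfolding nonholonomic_geodesic_def by blast
    then interpret framed_curve A g nabla m X J \<gamma> by unfold_locales (rule app)
    have "\<exists>c. \<forall>t\<in>J. coef vel l t = c" if l: "l \<in> {1..k}" for l
    proof -
      have lm: "l \<in> {1..m}" using l k by auto
      have "(coef vel l has_vector_derivative 0) (at t within J)" if t: "t \<in> J" for t
      proof -
        let ?d = "\<lambda>i. vector_derivative (coef vel i) (at t within J)"
        have "(\<Sum>l=1..k. ?d l *\<^sub>R X l (\<gamma> t)) = 0"
          using geo t projected_acceleration[OF k bracket hor t]
          unfolding nonholonomic_geodesic_def by simp
        then have "g (\<gamma> t) (\<Sum>l=1..k. ?d l *\<^sub>R X l (\<gamma> t)) (X l (\<gamma> t)) = 0"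
          using g_zero[OF frame_tangent[OF lm]] by (simp only:)
        then have "?d l = 0" using g_frame_sum[of "{1..k}" l "\<gamma> t" ?d] l lm k by simp
        then show ?thesis using coef_deriv[OF along_vel lm t] by simp
      qed
      then show ?thesis
        using has_vector_derivative_zero_constant[of J "coef vel l"] J(1) is_interval_convex by metis
    qed
    then obtain c where c: "\<And>l t. l \<in> {1..k} \<Longrightarrow> t \<in> J \<Longrightarrow> coef vel l t = c l" by metis
    have "vel t = (\<Sum>l=1..k. c l *\<^sub>R X l (\<gamma> t))" if t: "t \<in> J" for t
    proof -
      have "vel t = (\<Sum>l=1..k. coef vel l t *\<^sub>R X l (\<gamma> t))"
        using hor[OF t] span_frame_iff[OF k] unfolding horizontal_bundle_def coef_def by blast
      also have "\<dots> = (\<Sum>l=1..k. c l *\<^sub>R X l (\<gamma> t))" by (rule sum.cong) (use c t in auto)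
      finally show ?thesis .
    qed
    then have "integral_curve A (\<lambda>p. \<Sum>l=1..k. c l *\<^sub>R X l p) J \<gamma>"
      using d unfolding integral_curve_def by simp
    then show "\<exists>Y\<in>left_invariant_horizontal_fields k X. integral_curve A Y J \<gamma>"
      unfolding left_invariant_horizontal_fields_def by blast
  }
  assume "\<exists>Y\<in>left_invariant_horizontal_fields k X. integral_curve A Y J \<gamma>"
  then obtain c where c: "integral_curve A (\<lambda>p. \<Sum>l=1..k. c l *\<^sub>R X l p) J \<gamma>"
    unfolding left_invariant_horizontal_fields_def by blast
  have "(\<lambda>p. \<Sum>l=1..k. c l *\<^sub>R X l p) \<in> vector_fields A"
    by (rule vector_fields_linear_combination) (use k frame_field in auto)
  from integral_curve_smooth[OF atlas app this c]
  have smooth: "smooth_curve A J \<gamma>" .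
  then interpret framed_curve A g nabla m X J \<gamma> by unfold_locales (rule app)
  have "vector_derivative (coef vel l) (at t within J) = 0" if l: "l \<in> {1..k}" and t: "t \<in> J" for l t
  proof (rule coef_deriv_eqI[OF t has_vector_derivative_const[of "c l"]])
    fix s assume "s \<in> J"
    then have "vel s = (\<Sum>l=1..k. c l *\<^sub>R X l (\<gamma> s))" using c unfolding integral_curve_def by blast
    then have "coef vel l s = g (\<gamma> s) (\<Sum>l=1..k. c l *\<^sub>R X l (\<gamma> s)) (X l (\<gamma> s))" by (simp only: coef_def)
    then show "coef vel l s = c l" using g_frame_sum[of "{1..k}" l "\<gamma> s" c] l k by simp
  qed
  then have "(\<Sum>l=1..k. vector_derivative (coef vel l) (at t within J) *\<^sub>R X l (\<gamma> t)) = 0" if "t \<in> J" for t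
    using that by (intro sum.neutral ballI) simp
  then show "nonholonomic_geodesic A g nabla (horizontal_bundle k X) J \<gamma>"
    unfolding nonholonomic_geodesic_def using smooth horizontal projected_acceleration[OF k bracket hor] by simp
qed

section \<open>Left-invariant fields on Lie groups\<close>

locale Lie_group_atlas =
  fixes A :: "('a::{t2_space, second_countable_topology}, 'e::euclidean_space) chart set"
    and G :: "'a monoid" (structure)
  assumes lie_group: "lie_group A G"
begin

lemma atlas: "smooth_atlas A"
  and carrier: "carrier G = UNIV"
  and continuous_mult: "continuous_on UNIV (\<lambda>(x, y). x \<otimes> y)"
  using lie_group unfolding lie_group_def by auto

lemma chart_mult_smooth:
  assumes "(U, \<phi>) \<in> A" "(V, \<psi>) \<in> A" "(W, \<theta>) \<in> A"
  shows "smooth_on {(x, y). x \<in> \<phi> ` U \<and> y \<in> \<psi> ` V \<and> inv_into U \<phi> x \<otimes> inv_into V \<psi> y \<in> W}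
          (\<lambda>(x, y). \<theta> (inv_into U \<phi> x \<otimes> inv_into V \<psi> y))"
proof -
  have "\<forall>(U, \<phi>)\<in>A. \<forall>(V, \<psi>)\<in>A. \<forall>(W, \<theta>)\<in>A.
        smooth_on {(x, y). x \<in> \<phi> ` U \<and> y \<in> \<psi> ` V \<and> inv_into U \<phi> x \<otimes> inv_into V \<psi> y \<in> W}
          (\<lambda>(x, y). \<theta> (inv_into U \<phi> x \<otimes> inv_into V \<psi> y))"
    using lie_group unfolding lie_group_def by simp
  from bspec[OF bspec[OF bspec[OF this assms(1), unfolded prod.case] assms(2),
        unfolded prod.case] assms(3), unfolded prod.case]
  show ?thesis .
qed

sublocale group G
  using lie_group unfolding lie_group_def by blast

lemma mult_inv_cancel: "a \<otimes> (inv a \<otimes> x) = x"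
  using inv_closed[of a] m_assoc[of a "inv a" x] r_inv[of a] by (simp add: carrier)

lemma inv_mult: "inv p \<otimes> p = \<one>"
  using l_inv[of p] by (simp add: carrier)

lemma mult_one: "p \<otimes> \<one> = p"
  using r_one[of p] by (simp add: carrier)

text \<open>
  In charts around \<open>a\<close>, around a point and around its translate, the left translation is the
  multiplication in coordinates with its first argument fixed at the coordinates of \<open>a\<close>.
\<close>

lemma smooth_funs_left_translation:
  assumes f: "f \<in> smooth_funs A"
  shows "(\<lambda>x. f (a \<otimes> x)) \<in> smooth_funs A"
  unfolding smooth_funs_def
proof clarify
  fix U and \<phi> :: "'a \<Rightarrow> 'e" assume U: "(U, \<phi>) \<in> A"
  note u = smooth_atlas_chart[OF atlas U]
  obtain V \<psi> where V: "(V, \<psi>) \<in> A" "a \<in> V" using smooth_atlas_covers[OF atlas] by metis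
  note v = smooth_atlas_chart[OF atlas V(1)]
  have "smooth_on (\<phi> ` U) (\<lambda>x. f (a \<otimes> inv_into U \<phi> x))"
  proof (rule smooth_on_local[OF approachable_open[OF u(2)]])
    fix x0 assume x0: "x0 \<in> \<phi> ` U"
    obtain W \<theta> where W: "(W, \<theta>) \<in> A" "a \<otimes> inv_into U \<phi> x0 \<in> W"
      using smooth_atlas_covers[OF atlas] by metis
    note w = smooth_atlas_chart[OF atlas W(1)]
    have "continuous_on (\<phi> ` U) (\<lambda>x. case (a, inv_into U \<phi> x) of (x, y) \<Rightarrow> x \<otimes> y)"
      by (rule continuous_on_compose2[OF continuous_mult])
         (use u(5) in \<open>auto intro!: continuous_intros\<close>)
    then have c: "continuous_on (\<phi> ` U) (\<lambda>x. a \<otimes> inv_into U \<phi> x)" by simp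
    obtain N where N: "open N" "\<And>x. x \<in> \<phi> ` U \<Longrightarrow> x \<in> N \<longleftrightarrow> a \<otimes> inv_into U \<phi> x \<in> W"
      using curve_preimage_open[OF c w(1)] by metis
    let ?D = "{(x, y). x \<in> \<psi> ` V \<and> y \<in> \<phi> ` U \<and> inv_into V \<psi> x \<otimes> inv_into U \<phi> y \<in> W}"
    let ?\<mu> = "\<lambda>(x, y). \<theta> (inv_into V \<psi> x \<otimes> inv_into U \<phi> y)"
    have "smooth_on ?D (\<lambda>z. f (inv_into W \<theta> (?\<mu> z)))"
      by (rule smooth_on_compose[OF smooth_funs_chart[OF f W(1)] chart_mult_smooth[OF V(1) U W(1)]])
         auto
    moreover have "smooth_on (\<phi> ` U \<inter> N) (\<lambda>x. (\<psi> a, 0) + (0, x))"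
      by (intro smooth_on_add smooth_on_const smooth_on_bounded_linear bounded_linear_Pair
          bounded_linear_zero bounded_linear_ident)
    moreover have "(\<lambda>x. (\<psi> a, 0) + (0, x)) ` (\<phi> ` U \<inter> N) \<subseteq> ?D"
      using V(2) v(6) N(2) by auto
    ultimately have "smooth_on (\<phi> ` U \<inter> N) (\<lambda>x. f (inv_into W \<theta> (?\<mu> ((\<psi> a, 0) + (0, x)))))"
      by (rule smooth_on_compose)
    then have "smooth_on (\<phi> ` U \<inter> N) (\<lambda>x. f (a \<otimes> inv_into U \<phi> x))"
      by (rule smooth_on_cong) (use V(2) v(6) w(6) N(2) in auto)
    then show "smooth_near (\<phi> ` U) x0 (\<lambda>x. f (a \<otimes> inv_into U \<phi> x))"
      unfolding smooth_near_def using N W(2) x0 by blast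
  qed
  then show "smooth_on (\<phi> ` U) ((\<lambda>x. f (a \<otimes> x)) \<circ> inv_into U \<phi>)" by (simp add: o_def)
qed

lemma smooth_funs_left_translation_iff:
  "(\<lambda>x. f (a \<otimes> x)) \<in> smooth_funs A \<longleftrightarrow> f \<in> smooth_funs A"
  using smooth_funs_left_translation[of f a]
    smooth_funs_left_translation[of "\<lambda>x. f (a \<otimes> x)" "inv a"]
  by (auto simp: mult_inv_cancel)

lemma ltrans_tangent:
  assumes v: "v \<in> tangent_space A p"
  shows "ltrans G a v \<in> tangent_space A (a \<otimes> p)"
  unfolding tangent_space_def
proof (intro CollectI conjI allI ballI impI)
  fix f assume "f \<notin> smooth_funs A"
  then have "(\<lambda>x. f (a \<otimes> x)) \<notin> smooth_funs A" by (simp add: smooth_funs_left_translation_iff)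
  then show "ltrans G a v f = 0" using v unfolding tangent_space_def ltrans_def by blast
next
  fix f c assume f: "f \<in> smooth_funs A"
  have "v (c *\<^sub>R (\<lambda>x. f (a \<otimes> x))) = c * v (\<lambda>x. f (a \<otimes> x))"
    using v smooth_funs_left_translation[OF f] unfolding tangent_space_def by blast
  then show "ltrans G a v (c *\<^sub>R f) = c * ltrans G a v f" by (simp add: ltrans_def scaleR_fun_def)
next
  fix f h assume f: "f \<in> smooth_funs A" and h: "h \<in> smooth_funs A"
  let ?f = "\<lambda>x. f (a \<otimes> x)" and ?h = "\<lambda>x. h (a \<otimes> x)"
  have "v (?f + ?h) = v ?f + v ?h" "v (?f * ?h) = ?f p * v ?h + ?h p * v ?f"
    using v smooth_funs_left_translation[OF f] smooth_funs_left_translation[OF h]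
    unfolding tangent_space_def by blast+
  then show "ltrans G a v (f + h) = ltrans G a v f + ltrans G a v h"
    "ltrans G a v (f * h) = f (a \<otimes> p) * ltrans G a v h + h (a \<otimes> p) * ltrans G a v f"
    by (simp_all add: ltrans_def plus_fun_def times_fun_def)
qed

lemma ltrans_ltrans_inv: "ltrans G a (ltrans G (inv a) v) = v"
  by (simp add: ltrans_def mult_inv_cancel)

lemma ltrans_sum: "ltrans G a (\<Sum>i\<in>I. c i *\<^sub>R u i) = (\<Sum>i\<in>I. c i *\<^sub>R ltrans G a (u i))"
  by (simp add: fun_eq_iff ltrans_def sum_fun_apply)

lemma left_invariant_at:
  assumes "Y \<in> left_invariant_fields A G"
  shows "Y p = ltrans G p (Y \<one>)"
proof -
  have "Y (p \<otimes> \<one>) = ltrans G p (Y \<one>)" using assms unfolding left_invariant_fields_def by blast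
  then show ?thesis by (simp only: mult_one)
qed

text \<open>
  Left translation by the inverse of \<open>p\<close> moves a tangent vector at \<open>p\<close> to the identity, and left
  translation by \<open>p\<close> moves its expansion in the basis back.
\<close>

lemma tangent_span_left_invariant:
  fixes m :: nat
  assumes fields: "\<And>i. i \<in> {1..m} \<Longrightarrow> X i \<in> left_invariant_fields A G"
    and span: "span ((\<lambda>i. X i \<one>) ` {1..m}) = tangent_space A \<one>"
    and u: "u \<in> tangent_space A p"
  shows "u \<in> span ((\<lambda>i. X i p) ` {1..m})"
proof -
  have w: "ltrans G (inv p) u \<in> span ((\<lambda>i. X i \<one>) ` {1..m})"
    using ltrans_tangent[OF u, of "inv p"] by (simp only: inv_mult span)
  obtain c where c: "ltrans G (inv p) u = (\<Sum>i\<in>{1..m}. c i *\<^sub>R X i \<one>)"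
    by (rule span_image_sum[OF finite_atLeastAtMost w])
  have "u = ltrans G p (\<Sum>i\<in>{1..m}. c i *\<^sub>R X i \<one>)"
    by (simp only: c[symmetric] ltrans_ltrans_inv)
  also have "\<dots> = (\<Sum>i\<in>{1..m}. c i *\<^sub>R ltrans G p (X i \<one>))" by (rule ltrans_sum)
  also have "\<dots> = (\<Sum>i\<in>{1..m}. c i *\<^sub>R X i p)"
    by (intro sum.cong refl arg_cong2[of _ _ _ _ scaleR] left_invariant_at[symmetric] fields)
  also have "\<dots> \<in> span ((\<lambda>i. X i p) ` {1..m})"
    by (intro span_sum span_scale span_base) blast
  finally show ?thesis .
qed

lemma lie_bracket_left_invariant:
  assumes Y: "Y \<in> left_invariant_fields A G" and Z: "Z \<in> left_invariant_fields A G"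
  shows "lie_bracket Y Z (a \<otimes> p) = ltrans G a (lie_bracket Y Z p)"
proof -
  have inv: "S (a \<otimes> p) f = S p (\<lambda>x. f (a \<otimes> x))" if "S \<in> left_invariant_fields A G" for S p f
    using that unfolding left_invariant_fields_def ltrans_def by simp
  show ?thesis
    by (simp add: fun_eq_iff lie_bracket_def ltrans_def dir_deriv_def inv[OF Y] inv[OF Z])
qed

lemma alg_bracket_left_invariant:
  assumes Y: "Y \<in> left_invariant_fields A G" and Z: "Z \<in> left_invariant_fields A G"
  shows "alg_bracket G (Y \<one>) (Z \<one>) = lie_bracket Y Z \<one>"
  unfolding alg_bracket_def
  by (simp only: left_invariant_at[OF Y, symmetric] left_invariant_at[OF Z, symmetric])

end

section \<open>Carnot groups\<close>

text \<open>
  The block boundaries \<open>d\<close> increase up to \<open>d l = m\<close>, so the first two blocks consist of basis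
  vectors with indices up to \<open>m\<close>.
\<close>

lemma adapted_basis_blocks:
  assumes grading: "carnot_grading A G l V" and basis: "adapted_basis A G l V m k e"
  shows "k \<le> m" "span (e ` {1..k}) = V 1"
    "l \<noteq> 1 \<Longrightarrow> \<exists>d\<le>m. span (e ` {k<..d}) = V 2"
proof -
  have l: "1 \<le> l" using grading unfolding carnot_grading_def by blast
  obtain d :: "nat \<Rightarrow> nat" where d: "d 0 = 0" "d 1 = k" "d l = m"
    and step: "\<And>j. j \<in> {1..l} \<Longrightarrow> d (j - 1) \<le> d j"
    and span: "\<And>j. j \<in> {1..l} \<Longrightarrow> span (e ` {d (j - 1)<..d j}) = V j"
    using basis unfolding adapted_basis_def basis_on_def by blast
  have mono: "d j \<le> m" if "j \<le> l" for j
    using that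
  proof (induction rule: inc_induct)
    case base
    show ?case using d by simp
  next
    case (step n)
    have "d n \<le> d (Suc n)" using \<open>\<And>j. j \<in> {1..l} \<Longrightarrow> d (j - 1) \<le> d j\<close>[of "Suc n"] step by simp
    then show ?case using step by simp
  qed
  show "k \<le> m" using mono[OF l] d by simp
  have "{0<..k} = {1..k}" by auto
  then show "span (e ` {1..k}) = V 1" using span[of 1] d l by simp
  show "\<exists>d\<le>m. span (e ` {k<..d}) = V 2" if "l \<noteq> 1"
    using span[of 2] mono[of 2] d l that by (intro exI[of _ "d 2"]) (simp add: numeral_2_eq_2)
qed

text \<open>
  Brackets of elements of \<open>V 1\<close> lie in \<open>V 2\<close>, whose basis vectors come after those of \<open>V 1\<close>; in
  step one the brackets vanish, and the sum is empty.
\<close>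

lemma carnot_horizontal_bracket:
  assumes grading: "carnot_grading A G l V" and basis: "adapted_basis A G l V m k e"
    and ij: "i \<in> {1..k}" "j \<in> {1..k}"
  obtains d c where "d \<le> m" "alg_bracket G (e i) (e j) = (\<Sum>r\<in>{k<..d}. c r *\<^sub>R e r)"
proof -
  note b = adapted_basis_blocks[OF grading basis]
  have e1: "e i \<in> V 1" "e j \<in> V 1" using b(2) ij by (metis imageI span_base)+
  show ?thesis
  proof (cases "l = 1")
    case True
    then have "alg_bracket G (e i) (e j) = 0"
      using grading e1 unfolding carnot_grading_def by blast
    then show ?thesis using that[of 0 "\<lambda>_. 0"] by simp
  next
    case False
    then obtain d where d: "d \<le> m" "span (e ` {k<..d}) = V 2" using b(3) by blast
    have "1 \<in> {1..<l}" using False grading unfolding carnot_grading_def by auto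
    then have "span {alg_bracket G u v | u v. u \<in> V 1 \<and> v \<in> V 1} = V 2"
      using grading unfolding carnot_grading_def numeral_2_eq_2 One_nat_def by blast
    moreover have "alg_bracket G (e i) (e j) \<in> span {alg_bracket G u v | u v. u \<in> V 1 \<and> v \<in> V 1}"
      by (rule span_base) (use e1 in blast)
    ultimately have "alg_bracket G (e i) (e j) \<in> span (e ` {k<..d})" using d by simp
    then obtain c where "alg_bracket G (e i) (e j) = (\<Sum>r\<in>{k<..d}. c r *\<^sub>R e r)"
      by (rule span_image_sum[OF finite_greaterThanAtMost])
    then show ?thesis by (rule that[OF d(1)])
  qed
qed

theorem corollary3p14:
  fixes A :: "('a::{t2_space, second_countable_topology}, 'e::euclidean_space) chart set"
    and G :: "'a monoid"
    and l m k :: nat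
    and V :: "nat \<Rightarrow> 'a tvec set"
    and e :: "nat \<Rightarrow> 'a tvec"
    and X :: "nat \<Rightarrow> 'a vfield"
    and g :: "'a \<Rightarrow> 'a tvec \<Rightarrow> 'a tvec \<Rightarrow> real"
    and nabla :: "'a vfield \<Rightarrow> 'a vfield \<Rightarrow> 'a vfield"
    and J :: "real set"
    and \<gamma> :: "real \<Rightarrow> 'a"
  assumes carnot: "carnot_group A G l V"
    and basis: "adapted_basis A G l V m k e"
    and fields: "\<forall>i\<in>{1..m}. X i \<in> left_invariant_fields A G \<and> X i \<one>\<^bsub>G\<^esub> = e i"
    and metric: "left_invariant_metric A G g"
    and orthonormal: "\<forall>p. \<forall>i\<in>{1..m}. \<forall>j\<in>{1..m}. g p (X i p) (X j p) = (if i = j then 1 else 0)"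
    and connection: "levi_civita A g nabla"
    and interval: "is_interval J" "interior J \<noteq> {}"
    and horizontal: "horizontal_curve A (horizontal_bundle k X) J \<gamma>"
  shows "nonholonomic_geodesic A g nabla (horizontal_bundle k X) J \<gamma> \<longleftrightarrow>
         (\<exists>Y\<in>left_invariant_horizontal_fields k X. integral_curve A Y J \<gamma>)"
proof -
  have lie: "lie_group A G" and grading: "carnot_grading A G l V"
    using carnot unfolding carnot_group_def by auto
  interpret Lie_group_atlas A G by unfold_locales (rule lie)
  have left_inv: "X i \<in> left_invariant_fields A G" and at_one: "X i \<one>\<^bsub>G\<^esub> = e i"
    if "i \<in> {1..m}" for i
    using fields that by auto
  have invariance: "g (a \<otimes>\<^bsub>G\<^esub> p) (ltrans G a u) (ltrans G a v) = g p u v"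
    if "u \<in> tangent_space A p" "v \<in> tangent_space A p" for a p u v
    using metric that unfolding left_invariant_metric_def by simp
  note blocks = adapted_basis_blocks[OF grading basis]
  have km: "i \<in> {1..m}" if "i \<in> {1..k}" for i using blocks(1) that by auto
  have "(\<lambda>i. X i \<one>\<^bsub>G\<^esub>) ` {1..m} = e ` {1..m}" by (rule image_cong) (auto simp: at_one)
  then have span: "span ((\<lambda>i. X i \<one>\<^bsub>G\<^esub>) ` {1..m}) = tangent_space A \<one>\<^bsub>G\<^esub>"
    using basis unfolding adapted_basis_def basis_on_def lie_algebra_def by simp
  interpret orthonormal_frame A g nabla m X
  proof
    show "riemannian_metric A g" using metric unfolding left_invariant_metric_def by blast
    show "X i \<in> vector_fields A" if "i \<in> {1..m}" for i
      using left_inv[OF that] unfolding left_invariant_fields_def by blast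
    show "u \<in> span ((\<lambda>i. X i p) ` {1..m})" if "u \<in> tangent_space A p" for u p
      by (rule tangent_span_left_invariant[OF left_inv span that])
  qed (use atlas connection orthonormal in auto)
  have "g p (lie_bracket (X i) (X j) p) (X r p) = 0"
    if ijr: "i \<in> {1..k}" "j \<in> {1..k}" "r \<in> {1..k}" for p i j r
  proof -
    \<comment> \<open>at the identity the bracket lies in the span of later frame vectors; left invariance of the
      bracket, of the frame and of the metric carries the orthogonality to \<open>p\<close>\<close>
    let ?B = "lie_bracket (X i) (X j)"
    note li = left_inv[OF km[OF ijr(1)]] left_inv[OF km[OF ijr(2)]] left_inv[OF km[OF ijr(3)]]
    obtain d c where d: "d \<le> m"
      and c: "alg_bracket G (e i) (e j) = (\<Sum>s\<in>{k<..d}. c s *\<^sub>R e s)"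
      using carnot_horizontal_bracket[OF grading basis ijr(1,2)] by metis
    have "?B \<one>\<^bsub>G\<^esub> = (\<Sum>s\<in>{k<..d}. c s *\<^sub>R e s)"
      using alg_bracket_left_invariant[OF li(1,2)] c at_one km ijr by simp
    also have "\<dots> = (\<Sum>s\<in>{k<..d}. c s *\<^sub>R X s \<one>\<^bsub>G\<^esub>)"
      by (intro sum.cong refl arg_cong2[of _ _ _ _ scaleR] at_one[symmetric]) (use d in auto)
    finally have B: "?B \<one>\<^bsub>G\<^esub> = (\<Sum>s\<in>{k<..d}. c s *\<^sub>R X s \<one>\<^bsub>G\<^esub>)" .
    have sub: "{k<..d} \<subseteq> {1..m}" using d by auto
    have T: "?B \<one>\<^bsub>G\<^esub> \<in> tangent_space A \<one>\<^bsub>G\<^esub>"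
      unfolding B by (intro subspace_sum subspace_scale subspace_tangent_space frame_tangent) (use sub in blast)
    have "?B p = ltrans G p (?B \<one>\<^bsub>G\<^esub>)"
      using lie_bracket_left_invariant[OF li(1,2), of p "\<one>\<^bsub>G\<^esub>"] by (simp only: mult_one)
    moreover have "X r p = ltrans G p (X r \<one>\<^bsub>G\<^esub>)" by (rule left_invariant_at[OF li(3)])
    moreover have "g (p \<otimes>\<^bsub>G\<^esub> \<one>\<^bsub>G\<^esub>) (ltrans G p (?B \<one>\<^bsub>G\<^esub>)) (ltrans G p (X r \<one>\<^bsub>G\<^esub>))
        = g \<one>\<^bsub>G\<^esub> (?B \<one>\<^bsub>G\<^esub>) (X r \<one>\<^bsub>G\<^esub>)"
      by (rule invariance[OF T frame_tangent[OF km[OF ijr(3)]]])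
    ultimately have "g p (?B p) (X r p) = g \<one>\<^bsub>G\<^esub> (?B \<one>\<^bsub>G\<^esub>) (X r \<one>\<^bsub>G\<^esub>)"
      by (simp only: mult_one)
    also have "\<dots> = 0"
      using g_frame_sum[OF sub km[OF ijr(3)], of "\<one>\<^bsub>G\<^esub>" c] ijr(3) unfolding B by simp
    finally show ?thesis .
  qed
  then show ?thesis
    by (rule nonholonomic_geodesic_iff_constant_coefficients[OF blocks(1) _ interval horizontal])
qed

end
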